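(* Let $K$ be a compact space and let $(r^n_s)_{s\in\Gamma_n}$, $n\in\omega$, be a sequence of retractional skeletons on $K$ inducing the same set $D$. Then there exists a retractional skeleton on $K$ which is a weak subskeleton of $(r^n_s)_{s\in\Gamma_n}$ for every $n\in\omega$. Moreover, for every countable set $S$ and every finite list of formulas $\Phi$, there exists a family $\mathcal{M}$ consisting of countable sets $M$ with $M\prec(\Phi;S)$ such that every $M\in\mathcal{M}$ admits canonical retraction $r_M$ associated to $M$, $K$ and $D$, and $(r_M)_{M\in\mathcal{M}}$ is a weak subskeleton of $(r^n_s)_{s\in\Gamma_n}$ for every $n\in\omega$, where the ordering on $\mathcal{M}$ is given by inclusion.
   Context: All topological spaces are Tychonoff; retractions are continuous; $\mathcal{C}(K)$ is the set of real-valued continuous functions on $K$. Up-directed means nonempty and any two elements have an upper bound. An up-directed partially ordered set $\Gamma$ is $\sigma$-complete if every increasing sequence $(s_n)_{n\in\omega}$ ($s_n\le s_{n+1}$) has a supremum in $\Gamma$. A retractional skeleton on a compact space $K$ is a family $(r_s)_{s\in\Gamma}$ of continuous retractions on $K$ indexed by an up-directed $\sigma$-complete partially ordered set $\Gamma$ such that: (1) $r_s[K]$ is metrizable compact for each $s$; (2) if $s\le t$ then $r_s=r_t\circ r_s=r_s\circ r_t$; (3) if $(s_n)$ is increasing with $s=\sup_n s_n$, then $r_s(x)=\lim_n r_{s_n}(x)$ for every $x\in K$; (4) $x=\lim_{s\in\Gamma}r_s(x)$ for every $x\in K$. The set induced by it is $\bigcup_{s\in\Gamma}r_s[K]$. $(R_i)_{i\in\Lambda}$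 is a weak subskeleton of a retractional skeleton $(r_s)_{s\in\Gamma}$ on $K$ if $(R_i)_{i\in\Lambda}$ is a retractional skeleton on $K$ and there is a mapping $\phi:\Lambda\to\Gamma$ such that: $R_i=r_{\phi(i)}$ for every $i\in\Lambda$; $\phi$ is $\omega$-monotone, i.e. $i\le j$ implies $\phi(i)\le\phi(j)$, and $\sup_n\phi(i_n)=\phi(\sup_n i_n)$ for every increasing sequence $(i_n)_{n\in\omega}$ in $\Lambda$; and $\{\phi(i):i\in\Lambda\}$ is cofinal in $\Gamma$. For a set $N$ and a formula $\phi$ of the language of set theory, the relativization $\phi^N$ is obtained by replacing each quantifier $\exists x$ by $\exists x\in N$ (and $\forall x$ by $\forall x\in N$). A formula $\phi(x_1,\dots,x_n)$ (all free variables shown) is absolute for $N$ if for all $a_1,\dots,a_n\in N$: $\phi^N(a_1,\dots,a_n)\leftrightarrow\phi(a_1,\dots,a_n)$. For a finite list of formulas $\Phi$ and a set $X$, $M\prec(\Phi;X)$ ("$M$ is a suitable model for $\Phi$ containing $X$") means that $M\supset X$ is a set such that every formula in $\Phi$ is absolute for $M$. Given a set $M$ and a dense $D\subset K$ contained in the set induced by a retractional skeleton, $M$ admits canonical retraction $r_M$ associated to $M$, $K$ and $D$ if $r_M$ is the unique retraction on $K$ satisfying $r_M[K]=\overline{D\cap M}$ and $f=f\circ r_M$ for every $f\in\mathcal{C}(K)\cap M$. *)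

theory Defs
  imports "HOL-Analysis.Analysis"
begin

section \<open>Up-directed posets\<close>

text \<open>A poset is a carrier \<open>\<Gamma>\<close> together with an order \<open>le\<close>; \<open>le\<close> is only ever
  considered on elements of \<open>\<Gamma>\<close>.\<close>

definition poset :: "'i set \<Rightarrow> ('i \<Rightarrow> 'i \<Rightarrow> bool) \<Rightarrow> bool" where
  "poset \<Gamma> le \<longleftrightarrow> reflp_on \<Gamma> le \<and> antisymp_on \<Gamma> le \<and> transp_on \<Gamma> le"

definition up_directed :: "'i set \<Rightarrow> ('i \<Rightarrow> 'i \<Rightarrow> bool) \<Rightarrow> bool" where
  "up_directed \<Gamma> le \<longleftrightarrow> \<Gamma> \<noteq> {} \<and> (\<forall>s\<in>\<Gamma>. \<forall>t\<in>\<Gamma>. \<exists>u\<in>\<Gamma>. le s u \<and> le t u)"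

definition increasing_seq :: "'i set \<Rightarrow> ('i \<Rightarrow> 'i \<Rightarrow> bool) \<Rightarrow> (nat \<Rightarrow> 'i) \<Rightarrow> bool" where
  "increasing_seq \<Gamma> le a \<longleftrightarrow> (\<forall>n. a n \<in> \<Gamma> \<and> le (a n) (a (Suc n)))"

definition is_sup_seq :: "'i set \<Rightarrow> ('i \<Rightarrow> 'i \<Rightarrow> bool) \<Rightarrow> (nat \<Rightarrow> 'i) \<Rightarrow> 'i \<Rightarrow> bool" where
  "is_sup_seq \<Gamma> le a s \<longleftrightarrow>
     s \<in> \<Gamma> \<and> (\<forall>n. le (a n) s) \<and> (\<forall>u\<in>\<Gamma>. (\<forall>n. le (a n) u) \<longrightarrow> le s u)"

definition sigma_complete :: "'i set \<Rightarrow> ('i \<Rightarrow> 'i \<Rightarrow> bool) \<Rightarrow> bool" where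
  "sigma_complete \<Gamma> le \<longleftrightarrow> (\<forall>a. increasing_seq \<Gamma> le a \<longrightarrow> (\<exists>s. is_sup_seq \<Gamma> le a s))"

text \<open>The filter of tails, so that limits along it are limits of nets indexed by \<open>\<Gamma>\<close>.\<close>

definition tails :: "'i set \<Rightarrow> ('i \<Rightarrow> 'i \<Rightarrow> bool) \<Rightarrow> 'i filter" where
  "tails \<Gamma> le = (INF s\<in>\<Gamma>. principal {t\<in>\<Gamma>. le s t})"

section \<open>Retractional skeletons\<close>

definition retraction_on :: "'a topology \<Rightarrow> ('a \<Rightarrow> 'a) \<Rightarrow> bool" where
  "retraction_on K r \<longleftrightarrow> retraction_maps K (subtopology K (r ` topspace K)) r id"

definition retractional_skeleton ::
  "'a topology \<Rightarrow> 'i set \<Rightarrow> ('i \<Rightarrow> 'i \<Rightarrow> bool) \<Rightarrow> ('i \<Rightarrow> 'a \<Rightarrow> 'a) \<Rightarrow> bool" where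
  "retractional_skeleton K \<Gamma> le r \<longleftrightarrow>
     poset \<Gamma> le \<and> up_directed \<Gamma> le \<and> sigma_complete \<Gamma> le \<and>
     (\<forall>s\<in>\<Gamma>. retraction_on K (r s)) \<and>
     (\<forall>s\<in>\<Gamma>. compactin K (r s ` topspace K) \<and>
             metrizable_space (subtopology K (r s ` topspace K))) \<and>
     (\<forall>s\<in>\<Gamma>. \<forall>t\<in>\<Gamma>. le s t \<longrightarrow>
        (\<forall>x\<in>topspace K. r s x = r t (r s x) \<and> r s x = r s (r t x))) \<and>
     (\<forall>a s. increasing_seq \<Gamma> le a \<and> is_sup_seq \<Gamma> le a s \<longrightarrow>
        (\<forall>x\<in>topspace K. limitin K (\<lambda>n. r (a n) x) (r s x) sequentially)) \<and>
     (\<forall>x\<in>topspace K. limitin K (\<lambda>s. r s x) x (tails \<Gamma> le))"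

definition induced_set :: "'a topology \<Rightarrow> 'i set \<Rightarrow> ('i \<Rightarrow> 'a \<Rightarrow> 'a) \<Rightarrow> 'a set" where
  "induced_set K \<Gamma> r = (\<Union>s\<in>\<Gamma>. r s ` topspace K)"

definition omega_monotone ::
  "'j set \<Rightarrow> ('j \<Rightarrow> 'j \<Rightarrow> bool) \<Rightarrow> 'i set \<Rightarrow> ('i \<Rightarrow> 'i \<Rightarrow> bool) \<Rightarrow> ('j \<Rightarrow> 'i) \<Rightarrow> bool" where
  "omega_monotone \<Lambda> le' \<Gamma> le \<phi> \<longleftrightarrow>
     (\<forall>i\<in>\<Lambda>. \<forall>j\<in>\<Lambda>. le' i j \<longrightarrow> le (\<phi> i) (\<phi> j)) \<and>
     (\<forall>a i. increasing_seq \<Lambda> le' a \<and> is_sup_seq \<Lambda> le' a i \<longrightarrow>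
        is_sup_seq \<Gamma> le (\<lambda>n. \<phi> (a n)) (\<phi> i))"

definition weak_subskeleton ::
  "'a topology \<Rightarrow> 'j set \<Rightarrow> ('j \<Rightarrow> 'j \<Rightarrow> bool) \<Rightarrow> ('j \<Rightarrow> 'a \<Rightarrow> 'a) \<Rightarrow>
   'i set \<Rightarrow> ('i \<Rightarrow> 'i \<Rightarrow> bool) \<Rightarrow> ('i \<Rightarrow> 'a \<Rightarrow> 'a) \<Rightarrow> bool" where
  "weak_subskeleton K \<Lambda> le' R \<Gamma> le r \<longleftrightarrow>
     retractional_skeleton K \<Lambda> le' R \<and>
     (\<exists>\<phi>. \<phi> ` \<Lambda> \<subseteq> \<Gamma> \<and>
          (\<forall>i\<in>\<Lambda>. \<forall>x\<in>topspace K. R i x = r (\<phi> i) x) \<and>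
          omega_monotone \<Lambda> le' \<Gamma> le \<phi> \<and>
          (\<forall>s\<in>\<Gamma>. \<exists>i\<in>\<Lambda>. le s (\<phi> i)))"

section \<open>A universe of sets\<close>

text \<open>The type \<open>'v\<close> with the relation \<open>E\<close> (read \<open>E x y\<close> as ``x is an element of y'') plays the
  role of the universe of sets. A collection \<open>X :: 'v set\<close> is a set of the universe if it is
  the extension of some \<open>a :: 'v\<close>.\<close>

definition ext :: "('v \<Rightarrow> 'v \<Rightarrow> bool) \<Rightarrow> 'v \<Rightarrow> 'v set" where
  "ext E a = {x. E x a}"

definition is_set :: "('v \<Rightarrow> 'v \<Rightarrow> bool) \<Rightarrow> 'v set \<Rightarrow> bool" where
  "is_set E X \<longleftrightarrow> (\<exists>a. ext E a = X)"

text \<open>Extensionality, foundation, pairing, union, power set, full (second-order) separation and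
  infinity. Choice is inherited from HOL. Separation over arbitrary subcollections makes
  ``open subset'', ``compact'', ``countable'' etc. mean the same inside and outside the universe.
  Replacement is deliberately not required: the universe may then be any rank-initial segment
  \<open>V\<^sub>\<alpha>\<close> with \<open>\<alpha> > \<omega>\<close> a limit, in particular one that reflects a prescribed finite list of
  formulas, as well as a full model of ZFC.\<close>

definition set_universe :: "('v \<Rightarrow> 'v \<Rightarrow> bool) \<Rightarrow> bool" where
  "set_universe E \<longleftrightarrow>
     inj (ext E) \<and>
     wf {(x, y). E x y} \<and>
     (\<forall>x y. is_set E {x, y}) \<and>
     (\<forall>a. is_set E (\<Union>y\<in>ext E a. ext E y)) \<and>
     (\<forall>a. is_set E {z. ext E z \<subseteq> ext E a}) \<and>
     (\<forall>a. \<forall>X\<subseteq>ext E a. is_set E X) \<and>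
     (\<exists>a. (\<exists>z\<in>ext E a. ext E z = {}) \<and>
          (\<forall>x\<in>ext E a. \<exists>y\<in>ext E a. ext E y = insert x (ext E x)))"

text \<open>Kuratowski pairs \<open>p = (x, y)\<close>.\<close>

definition is_pair :: "('v \<Rightarrow> 'v \<Rightarrow> bool) \<Rightarrow> 'v \<Rightarrow> 'v \<Rightarrow> 'v \<Rightarrow> bool" where
  "is_pair E p x y \<longleftrightarrow> (\<exists>a b. ext E a = {x} \<and> ext E b = {x, y} \<and> ext E p = {a, b})"

text \<open>The set \<open>w\<close> is the graph of \<open>f : K \<rightarrow> \<real>\<close>. The map \<open>c\<close> says which set of the universe each
  real number is (Dedekind cuts, classes of Cauchy sequences, ...).\<close>

definition is_graph ::
  "('v \<Rightarrow> 'v \<Rightarrow> bool) \<Rightarrow> (real \<Rightarrow> 'v) \<Rightarrow> 'v topology \<Rightarrow> ('v \<Rightarrow> real) \<Rightarrow> 'v \<Rightarrow> bool" where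
  "is_graph E c K f w \<longleftrightarrow> ext E w = {p. \<exists>x\<in>topspace K. is_pair E p x (c (f x))}"

text \<open>The members of \<open>\<C>(K) \<inter> M\<close>.\<close>

definition cont_funs_in ::
  "('v \<Rightarrow> 'v \<Rightarrow> bool) \<Rightarrow> (real \<Rightarrow> 'v) \<Rightarrow> 'v topology \<Rightarrow> 'v set \<Rightarrow> ('v \<Rightarrow> real) set" where
  "cont_funs_in E c K M =
     {f. continuous_map K euclideanreal f \<and> (\<exists>w\<in>M. is_graph E c K f w)}"

section \<open>Formulas of the language of set theory and suitable models\<close>

datatype fm =
    Mem nat nat
  | Eq nat nat
  | Neg fm
  | Conj fm fm
  | Disj fm fm
  | Imp fm fm
  | Iff fm fm
  | Ex nat fm
  | All nat fm

primrec free_vars :: "fm \<Rightarrow> nat set" where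
  "free_vars (Mem i j) = {i, j}"
| "free_vars (Eq i j) = {i, j}"
| "free_vars (Neg p) = free_vars p"
| "free_vars (Conj p q) = free_vars p \<union> free_vars q"
| "free_vars (Disj p q) = free_vars p \<union> free_vars q"
| "free_vars (Imp p q) = free_vars p \<union> free_vars q"
| "free_vars (Iff p q) = free_vars p \<union> free_vars q"
| "free_vars (Ex i p) = free_vars p - {i}"
| "free_vars (All i p) = free_vars p - {i}"

text \<open>\<open>rel_holds E N \<phi> v\<close> is the truth in the universe, under the assignment \<open>v\<close>, of the
  relativization of \<open>\<phi>\<close> to \<open>N\<close>; for \<open>N = UNIV\<close> it is the truth of \<open>\<phi>\<close> itself.\<close>

primrec rel_holds :: "('v \<Rightarrow> 'v \<Rightarrow> bool) \<Rightarrow> 'v set \<Rightarrow> fm \<Rightarrow> (nat \<Rightarrow> 'v) \<Rightarrow> bool" where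
  "rel_holds E N (Mem i j) v = E (v i) (v j)"
| "rel_holds E N (Eq i j) v = (v i = v j)"
| "rel_holds E N (Neg p) v = (\<not> rel_holds E N p v)"
| "rel_holds E N (Conj p q) v = (rel_holds E N p v \<and> rel_holds E N q v)"
| "rel_holds E N (Disj p q) v = (rel_holds E N p v \<or> rel_holds E N q v)"
| "rel_holds E N (Imp p q) v = (rel_holds E N p v \<longrightarrow> rel_holds E N q v)"
| "rel_holds E N (Iff p q) v = (rel_holds E N p v \<longleftrightarrow> rel_holds E N q v)"
| "rel_holds E N (Ex i p) v = (\<exists>a\<in>N. rel_holds E N p (v(i := a)))"
| "rel_holds E N (All i p) v = (\<forall>a\<in>N. rel_holds E N p (v(i := a)))"

text \<open>Only the free variables are required to be interpreted in \<open>N\<close>, so that the condition is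
  not vacuous for sentences when \<open>N\<close> is empty.\<close>

definition absolute_for :: "('v \<Rightarrow> 'v \<Rightarrow> bool) \<Rightarrow> 'v set \<Rightarrow> fm \<Rightarrow> bool" where
  "absolute_for E N p \<longleftrightarrow>
     (\<forall>v. (\<forall>i\<in>free_vars p. v i \<in> N) \<longrightarrow> (rel_holds E N p v \<longleftrightarrow> rel_holds E UNIV p v))"

definition suitable_model :: "('v \<Rightarrow> 'v \<Rightarrow> bool) \<Rightarrow> 'v set \<Rightarrow> fm list \<Rightarrow> 'v set \<Rightarrow> bool" where
  "suitable_model E M \<Phi> X \<longleftrightarrow> X \<subseteq> M \<and> (\<forall>p\<in>set \<Phi>. absolute_for E M p)"

section \<open>Canonical retractions\<close>

definition canonical_candidate ::
  "('v \<Rightarrow> 'v \<Rightarrow> bool) \<Rightarrow> (real \<Rightarrow> 'v) \<Rightarrow> 'v topology \<Rightarrow> 'v set \<Rightarrow> 'v set \<Rightarrow> ('v \<Rightarrow> 'v) \<Rightarrow> bool" where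
  "canonical_candidate E c K D M r \<longleftrightarrow>
     retraction_on K r \<and>
     r ` topspace K = K closure_of (D \<inter> M) \<and>
     (\<forall>f\<in>cont_funs_in E c K M. \<forall>x\<in>topspace K. f x = f (r x))"

text \<open>Uniqueness is that of maps on \<open>K\<close>: values outside \<open>topspace K\<close> are irrelevant.\<close>

definition canonical_retraction ::
  "('v \<Rightarrow> 'v \<Rightarrow> bool) \<Rightarrow> (real \<Rightarrow> 'v) \<Rightarrow> 'v topology \<Rightarrow> 'v set \<Rightarrow> 'v set \<Rightarrow> ('v \<Rightarrow> 'v) \<Rightarrow> bool" where
  "canonical_retraction E c K D M r \<longleftrightarrow>
     canonical_candidate E c K D M r \<and>
     (\<forall>r'. canonical_candidate E c K D M r' \<longrightarrow> (\<forall>x\<in>topspace K. r' x = r x))"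

end

theory Submission
  imports Defs
begin

text \<open>
  For a countable \<open>M\<close> closed under suitable operations every \<open>M \<inter> \<Gamma>\<^sub>n\<close> is up-directed; let
  \<open>R\<^sub>n\<close> be the retraction of the \<open>n\<close>-th skeleton at the supremum of \<open>M \<inter> \<Gamma>\<^sub>n\<close>. Since all
  skeletons induce \<open>D\<close>, closing off makes the image of each \<open>R\<^sub>n\<close> equal to the closure of
  \<open>D \<inter> M\<close>. A continuous real function on \<open>K\<close> factors through some retraction of any given
  skeleton, so for \<open>s \<in> \<Gamma>\<^sub>n\<close> there is \<open>t \<in> \<Gamma>\<^sub>m\<close> with \<open>r\<^sub>s = r\<^sub>s \<circ> r\<^sub>t\<close>; closing off under
  \<open>s \<mapsto> t\<close> gives \<open>R\<^sub>n = R\<^sub>n \<circ> R\<^sub>m\<close>, and as both have the same image, \<open>R\<^sub>n = R\<^sub>m\<close>. The closed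
  sets \<open>M\<close>, ordered by inclusion, index the common weak subskeleton. Closing off under Skolem
  functions as well, and under codes of functions separating the points of each \<open>r\<^sub>s[K]\<close>, makes
  \<open>M\<close> a suitable model and \<open>R\<^sub>0\<close> its canonical retraction.
\<close>

section \<open>Closing off under countably many operations\<close>

text \<open>\<open>H\<close> takes lists so that operations of every finite arity are covered at
  once, and returns sets so that several operations can be merged into one.\<close>

definition closed_under :: "('v list \<Rightarrow> 'v set) \<Rightarrow> 'v set \<Rightarrow> bool" where
  "closed_under H M \<longleftrightarrow> (\<forall>xs\<in>lists M. H xs \<subseteq> M)"

text \<open>The countable sets closed under one \<open>H\<close> with countable values form a closed
  unbounded family. In this form countably many properties can be imposed together, and the
  resulting family stays closed under unions of increasing sequences.\<close>

definition on_club :: "('v set \<Rightarrow> bool) \<Rightarrow> bool" where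
  "on_club P \<longleftrightarrow> (\<exists>H. (\<forall>xs. countable (H xs)) \<and> (\<forall>M. closed_under H M \<longrightarrow> P M))"

text \<open>A list has finitely many entries, so one member of the chain contains them all. This is
  why closure under \<open>H\<close> survives increasing unions.\<close>

lemma lists_UN_chain:
  fixes M :: "nat \<Rightarrow> 'v set"
  assumes "\<And>n. M n \<subseteq> M (Suc n)" and "xs \<in> lists (\<Union>n. M n)"
  shows "\<exists>n. xs \<in> lists (M n)"
  using assms(2)
proof (induction xs)
  case (Cons x xs)
  then obtain m n where "x \<in> M m" "xs \<in> lists (M n)"
    by auto
  moreover have "M i \<subseteq> M (max m n)" if "i \<le> max m n" for i
    using lift_Suc_mono_le[of M, OF assms(1) that] .
  ultimately have "x \<in> M (max m n)" "xs \<in> lists (M (max m n))"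
    using lists_mono by (meson max.cobounded1 subsetD, meson max.cobounded2 lists_mono subsetD)
  then show ?case
    by auto
qed auto

lemma closed_under_UN_chain:
  fixes M :: "nat \<Rightarrow> 'v set"
  assumes "\<And>n. M n \<subseteq> M (Suc n)" and "\<And>n. closed_under H (M n)"
  shows "closed_under H (\<Union>n. M n)"
  unfolding closed_under_def
proof
  fix xs assume "xs \<in> lists (\<Union>n. M n)"
  then obtain n where "xs \<in> lists (M n)"
    using lists_UN_chain[of M, OF assms(1)] by blast
  then show "H xs \<subseteq> (\<Union>n. M n)"
    using assms(2)[of n] unfolding closed_under_def by blast
qed

lemma closed_under_countable_superset:
  assumes "\<And>xs. countable (H xs)" and "countable A"
  obtains M where "A \<subseteq> M" "countable M" "closed_under H M"
proof -
  \<comment> \<open>One step adds the values of \<open>H\<close> at all lists over \<open>X\<close>,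
    and a countable set has only countably many lists. A list over the union of all stages lives in
    one stage, so its values enter at the next.\<close>
  define step where "step X = X \<union> (\<Union>xs\<in>lists X. H xs)" for X
  define M where "M n = (step ^^ n) A" for n
  have Suc_eq: "M (Suc n) = step (M n)" for n
    by (simp add: M_def)
  have count: "countable (M n)" for n
  proof (induction n)
    case (Suc n)
    then show ?case
      by (simp add: Suc_eq step_def assms(1))
  qed (simp add: M_def assms(2))
  have chain: "M n \<subseteq> M (Suc n)" for n
    by (auto simp: Suc_eq step_def)
  show thesis
  proof
    show "A \<subseteq> (\<Union>n. M n)"
      using UN_upper[of 0 UNIV M] by (simp add: M_def)
    show "countable (\<Union>n. M n)"
      using count by simp
    show "closed_under H (\<Union>n. M n)"
      unfolding closed_under_def
    proof
      fix xs assume "xs \<in> lists (\<Union>n. M n)"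
      then obtain n where "xs \<in> lists (M n)"
        using lists_UN_chain[of M, OF chain] by blast
      then have "H xs \<subseteq> M (Suc n)"
        by (auto simp: Suc_eq step_def)
      then show "H xs \<subseteq> (\<Union>n. M n)"
        by blast
    qed
  qed
qed

lemma on_clubE:
  assumes "on_club P"
  obtains H where "\<And>xs. countable (H xs)" "\<And>M. closed_under H M \<Longrightarrow> P M"
  using assms unfolding on_club_def by blast

lemma on_club_mono:
  assumes "on_club P" and "\<And>M. P M \<Longrightarrow> Q M"
  shows "on_club Q"
  using assms unfolding on_club_def by blast

text \<open>The union of countably many operations is again countable-valued, and closure under it
  is closure under each. The index type \<open>bool\<close> later yields conjunctions.\<close>

lemma on_club_all:
  fixes P :: "'b::countable \<Rightarrow> 'v set \<Rightarrow> bool"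
  assumes "\<And>n. on_club (P n)"
  shows "on_club (\<lambda>M. \<forall>n. P n M)"
proof -
  obtain H where H: "\<And>n xs. countable (H n xs)" "\<And>n M. closed_under (H n) M \<Longrightarrow> P n M"
    using assms unfolding on_club_def by metis
  have "closed_under (H n) M" if "closed_under (\<lambda>xs. \<Union>n. H n xs) M" for n M
    using that unfolding closed_under_def by blast
  moreover have "\<forall>xs. countable (\<Union>n. H n xs)"
    using H(1) by blast
  ultimately show ?thesis
    unfolding on_club_def using H(2) by (intro exI[of _ "\<lambda>xs. \<Union>n. H n xs"]) blast
qed

lemma on_club_conj:
  assumes "on_club P" and "on_club Q"
  shows "on_club (\<lambda>M. P M \<and> Q M)"
  by (rule on_club_mono[OF on_club_all[of "\<lambda>b. if b then P else Q"]])
    (use assms in \<open>auto split: if_splits\<close>)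

section \<open>Closing off under values and under witnesses\<close>

lemma on_club_lists:
  assumes "\<And>xs. countable (W xs)"
  shows "on_club (\<lambda>M. \<forall>xs\<in>lists M. W xs \<subseteq> M)"
  unfolding on_club_def closed_under_def using assms by blast

lemma on_club_superset:
  assumes "countable S"
  shows "on_club (\<lambda>M. S \<subseteq> M)"
  by (rule on_club_mono[OF on_club_lists[of "\<lambda>_. S"]]) (use assms in auto)

lemma on_club_elems:
  assumes "\<And>x. x \<in> A \<Longrightarrow> countable (W x)"
  shows "on_club (\<lambda>M. \<forall>x\<in>M \<inter> A. W x \<subseteq> M)"
proof (rule on_club_mono[OF on_club_lists])
  \<comment> \<open>Only singleton lists matter below; on other lists \<open>hd\<close> merely adds
    further countable sets.\<close>
  show "countable (if hd xs \<in> A then W (hd xs) else {})" for xs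
    using assms by simp
  show "\<forall>x\<in>M \<inter> A. W x \<subseteq> M"
    if "\<forall>xs\<in>lists M. (if hd xs \<in> A then W (hd xs) else {}) \<subseteq> M" for M
  proof
    fix x assume "x \<in> M \<inter> A"
    then show "W x \<subseteq> M"
      using bspec[OF that, of "[x]"] by simp
  qed
qed

lemma on_club_witness_lists:
  "on_club (\<lambda>M. \<forall>xs\<in>lists M. (\<exists>y. Q xs y) \<longrightarrow> (\<exists>y\<in>M. Q xs y))"
proof (rule on_club_mono[OF on_club_lists])
  \<comment> \<open>A Skolem function; where no witness exists, \<open>SOME\<close> adds an
    arbitrary element, which does no harm.\<close>
  show "countable {SOME y. Q xs y}" for xs
    by simp
  show "\<forall>xs\<in>lists M. (\<exists>y. Q xs y) \<longrightarrow> (\<exists>y\<in>M. Q xs y)"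
    if "\<forall>xs\<in>lists M. {SOME y. Q xs y} \<subseteq> M" for M
  proof (intro ballI impI)
    fix xs assume "xs \<in> lists M" "\<exists>y. Q xs y"
    then have "(SOME y. Q xs y) \<in> M" "Q xs (SOME y. Q xs y)"
      using that someI_ex[of "Q xs"] by simp_all
    then show "\<exists>y\<in>M. Q xs y"
      by blast
  qed
qed

lemma on_club_witness:
  assumes "\<And>x. x \<in> A \<Longrightarrow> \<exists>y. Q x y"
  shows "on_club (\<lambda>M. \<forall>x\<in>M \<inter> A. \<exists>y\<in>M. Q x y)"
proof (rule on_club_mono[OF on_club_witness_lists[of "\<lambda>xs. Q (hd xs)"]], intro ballI)
  fix M x
  assume "\<forall>xs\<in>lists M. (\<exists>y. Q (hd xs) y) \<longrightarrow> (\<exists>y\<in>M. Q (hd xs) y)" "x \<in> M \<inter> A"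
  then show "\<exists>y\<in>M. Q x y"
    using assms by (auto dest!: bspec[of _ _ "[x]"])
qed

lemma on_club_up_directed:
  assumes "up_directed \<Gamma> le"
  shows "on_club (\<lambda>M. up_directed (M \<inter> \<Gamma>) le)"
proof -
  obtain g where g: "g \<in> \<Gamma>"
    using assms unfolding up_directed_def by blast
  let ?Q = "\<lambda>xs u. u \<in> \<Gamma> \<and> le (xs ! 0) u \<and> le (xs ! 1) u"
  \<comment> \<open>Adding \<open>g\<close> makes the intersection nonempty; upper bounds are Skolem
    values at two-element lists.\<close>
  have "on_club (\<lambda>M. {g} \<subseteq> M \<and> (\<forall>xs\<in>lists M. (\<exists>u. ?Q xs u) \<longrightarrow> (\<exists>u\<in>M. ?Q xs u)))"
    by (intro on_club_conj on_club_superset on_club_witness_lists) simp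
  then show ?thesis
  proof (rule on_club_mono)
    fix M assume M: "{g} \<subseteq> M \<and> (\<forall>xs\<in>lists M. (\<exists>u. ?Q xs u) \<longrightarrow> (\<exists>u\<in>M. ?Q xs u))"
    have "\<exists>u\<in>M \<inter> \<Gamma>. le s u \<and> le t u" if "s \<in> M \<inter> \<Gamma>" "t \<in> M \<inter> \<Gamma>" for s t
    proof -
      have "\<exists>u. ?Q [s, t] u"
        using assms that unfolding up_directed_def by simp blast
      moreover have "[s, t] \<in> lists M"
        using that by simp
      ultimately have "\<exists>u\<in>M. ?Q [s, t] u"
        using M by blast
      then show ?thesis
        by auto
    qed
    then show "up_directed (M \<inter> \<Gamma>) le"
      using M g unfolding up_directed_def by blast
  qed
qed

section \<open>Suprema and tails in up-directed posets\<close>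

lemma eventually_tails:
  assumes "poset \<Gamma> le" and "up_directed \<Gamma> le"
  shows "eventually P (tails \<Gamma> le) \<longleftrightarrow> (\<exists>s\<in>\<Gamma>. \<forall>t\<in>\<Gamma>. le s t \<longrightarrow> P t)"
proof -
  \<comment> \<open>Directedness makes the tails a filter base, so eventual truth is truth on a
    single tail.\<close>
  have base: "\<exists>u\<in>\<Gamma>. principal {v\<in>\<Gamma>. le u v} \<le> inf (principal {v\<in>\<Gamma>. le s v}) (principal {v\<in>\<Gamma>. le t v})"
    if st: "s \<in> \<Gamma>" "t \<in> \<Gamma>" for s t
  proof -
    obtain u where u: "u \<in> \<Gamma>" "le s u" "le t u"
      using assms(2) st unfolding up_directed_def by blast
    have "le s v \<and> le t v" if "v \<in> \<Gamma>" "le u v" for v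
      using assms(1) st u that unfolding poset_def transp_on_def by blast
    then show ?thesis
      using u(1) by (intro bexI[of _ u]) auto
  qed
  have "eventually P (tails \<Gamma> le) \<longleftrightarrow> (\<exists>s\<in>\<Gamma>. eventually P (principal {t\<in>\<Gamma>. le s t}))"
    unfolding tails_def
    by (rule eventually_INF_base) (use assms(2) base in \<open>auto simp: up_directed_def\<close>)
  then show ?thesis
    by (auto simp: eventually_principal)
qed

text \<open>Dependent choice: each term is taken above its predecessor and above the next
  \<open>b n\<close>; reflexivity allows the start \<open>b 0\<close>.\<close>

lemma up_directed_dominating_seq:
  fixes b :: "nat \<Rightarrow> 'i"
  assumes "up_directed A le" and "\<And>n. b n \<in> A" and "reflp_on A le"
  obtains a where "increasing_seq A le a" "\<And>n. le (b n) (a n)"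
proof -
  have "\<exists>a. \<forall>n. (a n \<in> A \<and> le (b n) (a n)) \<and> le (a n) (a (Suc n))"
  proof (rule dependent_nat_choice)
    show "\<exists>x. x \<in> A \<and> le (b 0) x"
      using assms(2,3) unfolding reflp_on_def by blast
  next
    fix x n assume "x \<in> A \<and> le (b n) x"
    then show "\<exists>y. (y \<in> A \<and> le (b (Suc n)) y) \<and> le x y"
      using assms(1) assms(2)[of "Suc n"] unfolding up_directed_def by blast
  qed
  then show thesis
    using that unfolding increasing_seq_def by blast
qed

lemma increasing_seq_mono:
  assumes "increasing_seq A le a" and "reflp_on A le" and "transp_on A le" and "m \<le> n"
  shows "le (a m) (a n)"
  using \<open>m \<le> n\<close>
proof (induction n rule: dec_induct)
  case base
  then show ?case
    using assms unfolding increasing_seq_def reflp_on_def by blast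
next
  case (step n)
  then show ?case
    using assms(1,3) unfolding increasing_seq_def transp_on_def by blast
qed

text \<open>The supremum of \<open>M \<inter> \<Gamma> n\<close> must not depend on a chosen cofinal
  sequence, so that it is monotone in \<open>M\<close>; hence this version of
  \<open>is_sup_seq\<close> for sets.\<close>

definition is_lub :: "'i set \<Rightarrow> ('i \<Rightarrow> 'i \<Rightarrow> bool) \<Rightarrow> 'i set \<Rightarrow> 'i \<Rightarrow> bool" where
  "is_lub \<Gamma> le A s \<longleftrightarrow>
     s \<in> \<Gamma> \<and> (\<forall>x\<in>A. le x s) \<and> (\<forall>u\<in>\<Gamma>. (\<forall>x\<in>A. le x u) \<longrightarrow> le s u)"

text \<open>A cofinal sequence in \<open>A\<close> has the same upper bounds as
  \<open>A\<close>.\<close>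

lemma is_lub_cofinal_seq:
  assumes "poset \<Gamma> le" and "A \<subseteq> \<Gamma>" and "range a \<subseteq> A" and "\<And>x. x \<in> A \<Longrightarrow> \<exists>n. le x (a n)"
  shows "is_lub \<Gamma> le A s \<longleftrightarrow> is_sup_seq \<Gamma> le a s"
proof -
  have "(\<forall>x\<in>A. le x u) \<longleftrightarrow> (\<forall>n. le (a n) u)" if u: "u \<in> \<Gamma>" for u
  proof
    assume a: "\<forall>n. le (a n) u"
    show "\<forall>x\<in>A. le x u"
    proof
      fix x assume "x \<in> A"
      moreover from assms(4)[OF this] obtain n where "le x (a n)" ..
      ultimately show "le x u"
        using assms(1-3) a u unfolding poset_def transp_on_def by (meson rangeI subsetD)
    qed
  qed (use assms(3) in blast)
  then show ?thesis
    unfolding is_lub_def is_sup_seq_def by blast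
qed

lemma countable_directed_cofinal_seq:
  assumes "up_directed A le" and "countable A" and "reflp_on A le"
  obtains a where "increasing_seq A le a" "\<And>x. x \<in> A \<Longrightarrow> \<exists>n. le x (a n)"
proof -
  have "A \<noteq> {}"
    using assms(1) unfolding up_directed_def by blast
  then obtain a where a: "increasing_seq A le a" "\<And>n. le (from_nat_into A n) (a n)"
    using up_directed_dominating_seq[OF assms(1) _ assms(3), of "from_nat_into A"] from_nat_into
    by metis
  have "\<exists>n. le x (a n)" if "x \<in> A" for x
    using a(2)[of "to_nat_on A x"] assms(2) that by auto
  with a(1) that show thesis
    by blast
qed

section \<open>Separating sequences on compact metrizable spaces\<close>

lemma compact_metrizable_subseq:
  assumes "compact_space X" and "metrizable_space X" and "range \<sigma> \<subseteq> topspace X"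
  obtains l k where "strict_mono (k :: nat \<Rightarrow> nat)" "limitin X (\<sigma> \<circ> k) l sequentially"
proof -
  obtain M d where "Metric_space M d" and X: "X = Metric_space.mtopology M d"
    using assms(2) unfolding metrizable_space_def by blast
  then interpret Metric_space M d
    by blast
  show thesis
    using assms(1,3) that unfolding X compact_space_sequentially topspace_mtopology by blast
qed

lemma compact_metrizable_imp_separable:
  assumes "compact_space X" and "metrizable_space X"
  shows "separable_space X"
proof -
  obtain M d where "Metric_space M d" and X: "X = Metric_space.mtopology M d"
    using assms(2) unfolding metrizable_space_def by blast
  then interpret Metric_space M d
    by blast
  have "mtotally_bounded M"
    using assms(1) compactin_imp_mtotally_bounded unfolding X compact_space_def by simp
  \<comment> \<open>The finite nets for the radii \<open>1 / Suc n\<close> together form a countable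
    dense set.\<close>
  then have "\<forall>n::nat. \<exists>F. finite F \<and> F \<subseteq> M \<and> M \<subseteq> (\<Union>x\<in>F. mball x (1 / Suc n))"
    unfolding mtotally_bounded_def by simp
  then obtain F where F: "\<And>n::nat. finite (F n)" "\<And>n. F n \<subseteq> M"
      "\<And>n. M \<subseteq> (\<Union>x\<in>F n. mball x (1 / Suc n))"
    by metis
  have "x \<in> mtopology closure_of (\<Union>n. F n)" if "x \<in> M" for x
  proof -
    have "\<exists>y\<in>\<Union>n. F n. y \<in> mball x e" if "e > 0" for e
    proof -
      obtain n where "1 / Suc n < e"
        using \<open>e > 0\<close> by (metis nat_approx_posE)
      moreover obtain y where "y \<in> F n" "x \<in> mball y (1 / Suc n)"
        using F(3)[of n] \<open>x \<in> M\<close> by blast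
      ultimately show ?thesis
        by (force simp: commute)
    qed
    then show ?thesis
      using \<open>x \<in> M\<close> unfolding metric_closure_of by blast
  qed
  then have "mtopology closure_of (\<Union>n. F n) = M"
    using closure_of_subset_topspace by fastforce
  moreover have "countable (\<Union>n. F n)"
    using F(1) by (simp add: countable_finite)
  moreover have "(\<Union>n. F n) \<subseteq> M"
    using F(2) by blast
  ultimately show ?thesis
    unfolding separable_space_def X by auto
qed

text \<open>The functions are the distances to the points of a countable dense set.\<close>

lemma compact_metrizable_separating_seq:
  assumes "compact_space X" and "metrizable_space X"
  obtains f :: "nat \<Rightarrow> 'a \<Rightarrow> real" where "\<And>k. continuous_map X euclideanreal (f k)"
    "\<And>x y. \<lbrakk>x \<in> topspace X; y \<in> topspace X; \<And>k. f k x = f k y\<rbrakk> \<Longrightarrow> x = y"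
proof (cases "topspace X = {}")
  case True
  then show thesis
    using that[of "\<lambda>_ _. 0"] by simp
next
  case False
  obtain M d where "Metric_space M d" and X: "X = Metric_space.mtopology M d"
    using assms(2) unfolding metrizable_space_def by blast
  then interpret Metric_space M d
    by blast
  obtain C where C: "countable C" "C \<subseteq> M" "mtopology closure_of C = M"
    using compact_metrizable_imp_separable[OF assms] unfolding separable_space_def X by auto
  have "C \<noteq> {}"
    using C(3) False X by auto
  define f where "f k x = d (from_nat_into C k) x" for k x
  have in_M: "from_nat_into C k \<in> M" for k
    using from_nat_into[OF \<open>C \<noteq> {}\<close>] C(2) by blast
  show thesis
  proof
    fix k
    show "continuous_map X euclideanreal (f k)"
      using continuous_on_mdist[of "from_nat_into C k" "metric (M, d)"] in_M[of k]
      by (simp add: X f_def[abs_def] mtopology_of_def)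
  next
    fix x y
    assume "x \<in> topspace X" "y \<in> topspace X" and eq: "\<And>k. f k x = f k y"
    then have xy: "x \<in> M" "y \<in> M"
      by (simp_all add: X)
    show "x = y"
    proof (rule ccontr)
      assume "x \<noteq> y"
      then have "d x y > 0"
        using xy by simp
      moreover have "x \<in> mtopology closure_of C"
        using C(3) xy(1) by simp
      \<comment> \<open>\<open>c\<close> is closer to \<open>x\<close> than half of
        \<open>d x y\<close>; equal distances to \<open>c\<close> would violate the triangle
        inequality.\<close>
      ultimately obtain c where c: "c \<in> C" "c \<in> mball x (d x y / 2)"
        unfolding metric_closure_of by (auto dest!: spec[of _ "d x y / 2"])
      then have "d c x = d c y"
        using eq[of "to_nat_on C c"] C(1) by (simp add: f_def)
      then show False
        using c xy triangle[of x c y] by (auto simp: commute)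
    qed
  qed
qed

section \<open>A single retractional skeleton\<close>

lemma retraction_on_iff:
  "retraction_on K f \<longleftrightarrow> continuous_map K K f \<and> (\<forall>x\<in>topspace K. f (f x) = f x)"
proof (cases "continuous_map K K f")
  case True
  then have sub: "f ` topspace K \<subseteq> topspace K"
    by (rule continuous_map_image_subset_topspace)
  have "continuous_map (subtopology K (f ` topspace K)) K id"
    by (simp add: continuous_map_from_subtopology)
  moreover have "continuous_map K (subtopology K (f ` topspace K)) f"
    using True by (simp add: continuous_map_in_subtopology)
  ultimately show ?thesis
    using True sub unfolding retraction_on_def retraction_maps_def by (simp add: Int_absorb1)
next
  case False
  then show ?thesis
    unfolding retraction_on_def retraction_maps_def continuous_map_in_subtopology by blast
qed

lemma retraction_on_cong:
  assumes "retraction_on K f" and "\<And>x. x \<in> topspace K \<Longrightarrow> g x = f x"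
  shows "retraction_on K g"
proof -
  have f: "continuous_map K K f" "\<forall>x\<in>topspace K. f (f x) = f x"
    using assms(1) unfolding retraction_on_iff by auto
  have "continuous_map K K g"
    using continuous_map_eq[OF f(1)] assms(2) by metis
  moreover have "f x \<in> topspace K" if "x \<in> topspace K" for x
    using f(1) that unfolding continuous_map_def by blast
  ultimately show ?thesis
    using f(2) assms(2) unfolding retraction_on_iff by simp
qed

locale skeleton =
  fixes K :: "'a topology" and \<Gamma> :: "'i set" and le :: "'i \<Rightarrow> 'i \<Rightarrow> bool" and r :: "'i \<Rightarrow> 'a \<Rightarrow> 'a"
  assumes skel: "retractional_skeleton K \<Gamma> le r"
    and Hausdorff: "Hausdorff_space K"
begin

lemma poset: "poset \<Gamma> le"
  and directed: "up_directed \<Gamma> le"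
  and sigma: "sigma_complete \<Gamma> le"
  and retraction: "s \<in> \<Gamma> \<Longrightarrow> retraction_on K (r s)"
  and compact_image: "s \<in> \<Gamma> \<Longrightarrow> compactin K (r s ` topspace K)"
  and metrizable_image: "s \<in> \<Gamma> \<Longrightarrow> metrizable_space (subtopology K (r s ` topspace K))"
  and lim_sup: "\<lbrakk>increasing_seq \<Gamma> le a; is_sup_seq \<Gamma> le a s; x \<in> topspace K\<rbrakk>
    \<Longrightarrow> limitin K (\<lambda>n. r (a n) x) (r s x) sequentially"
  and lim_net: "x \<in> topspace K \<Longrightarrow> limitin K (\<lambda>s. r s x) x (tails \<Gamma> le)"
  and comp: "\<forall>s\<in>\<Gamma>. \<forall>t\<in>\<Gamma>. le s t \<longrightarrow>
    (\<forall>x\<in>topspace K. r s x = r t (r s x) \<and> r s x = r s (r t x))"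
  using skel unfolding retractional_skeleton_def by ((elim conjE, assumption) | blast)+

lemma le_refl: "reflp_on \<Gamma> le"
  and le_antisym: "antisymp_on \<Gamma> le"
  and le_trans: "transp_on \<Gamma> le"
  using poset unfolding poset_def by simp_all

text \<open>The compatibility axiom, oriented so that the smaller retraction absorbs the larger
  one.\<close>

lemma comp_lower:
  assumes "s \<in> \<Gamma>" "t \<in> \<Gamma>" "le s t" "x \<in> topspace K"
  shows "r t (r s x) = r s x" and "r s (r t x) = r s x"
proof -
  have *: "r s x = r t (r s x) \<and> r s x = r s (r t x)"
    using comp assms by blast
  show "r t (r s x) = r s x" "r s (r t x) = r s x"
    by (rule conjunct1[OF *, symmetric], rule conjunct2[OF *, symmetric])
qed

lemma continuous: "s \<in> \<Gamma> \<Longrightarrow> continuous_map K K (r s)"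
  using retraction unfolding retraction_on_iff by blast

lemma in_topspace: "s \<in> \<Gamma> \<Longrightarrow> x \<in> topspace K \<Longrightarrow> r s x \<in> topspace K"
  using continuous unfolding continuous_map_def by blast

lemma image_fixed:
  assumes "s \<in> \<Gamma>" "x \<in> r s ` topspace K"
  shows "r s x = x"
  using retraction[OF assms(1)] assms(2) unfolding retraction_on_iff by force

lemma image_mono:
  assumes "s \<in> \<Gamma>" "t \<in> \<Gamma>" "le s t"
  shows "r s ` topspace K \<subseteq> r t ` topspace K"
proof
  fix y assume "y \<in> r s ` topspace K"
  then obtain x where "x \<in> topspace K" "y = r s x"
    by blast
  then show "y \<in> r t ` topspace K"
    using comp_lower(1)[OF assms] in_topspace[OF assms(1)] by (metis imageI)
qed

lemma closed_image: "s \<in> \<Gamma> \<Longrightarrow> closedin K (r s ` topspace K)"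
  using compact_image Hausdorff compactin_imp_closedin by blast

lemma lub_unique:
  assumes "is_lub \<Gamma> le A s" "is_lub \<Gamma> le A t"
  shows "s = t"
  using assms le_antisym unfolding is_lub_def antisymp_on_def by blast

lemma lub_seq:
  assumes "A \<subseteq> \<Gamma>" "countable A" "up_directed A le"
  obtains a s where "range a \<subseteq> A" "increasing_seq \<Gamma> le a" "\<And>x. x \<in> A \<Longrightarrow> \<exists>n. le x (a n)"
    "is_lub \<Gamma> le A s" "is_sup_seq \<Gamma> le a s"
proof -
  have "reflp_on A le"
    using le_refl assms(1) unfolding reflp_on_def by blast
  then obtain a where a: "increasing_seq A le a" "\<And>x. x \<in> A \<Longrightarrow> \<exists>n. le x (a n)"
    using countable_directed_cofinal_seq[OF assms(3,2)] by blast
  have "range a \<subseteq> A" "increasing_seq \<Gamma> le a"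
    using a(1) assms(1) unfolding increasing_seq_def by blast+
  moreover from this obtain s where "is_sup_seq \<Gamma> le a s"
    using sigma unfolding sigma_complete_def by blast
  ultimately show thesis
    using that a(2) is_lub_cofinal_seq[OF poset assms(1)] by metis
qed

lemma lub_limit:
  assumes "A \<subseteq> \<Gamma>" "countable A" "up_directed A le" "is_lub \<Gamma> le A s"
  obtains a where "range a \<subseteq> A"
    "\<And>x. x \<in> topspace K \<Longrightarrow> limitin K (\<lambda>n. r (a n) x) (r s x) sequentially"
proof -
  obtain a t where a: "range a \<subseteq> A" "increasing_seq \<Gamma> le a" "is_lub \<Gamma> le A t" "is_sup_seq \<Gamma> le a t"
    using lub_seq[OF assms(1-3)] by metis
  then have "t = s"
    using lub_unique assms(4) by blast
  with a lim_sup that show thesis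
    by blast
qed

text \<open>Points of the image at \<open>s\<close> are limits of points of the smaller images;
  conversely these all lie in the image at \<open>s\<close>, which is compact and hence
  closed.\<close>

lemma lub_image:
  assumes "A \<subseteq> \<Gamma>" "countable A" "up_directed A le" "is_lub \<Gamma> le A s"
  shows "r s ` topspace K = K closure_of (\<Union>t\<in>A. r t ` topspace K)"
proof
  let ?U = "\<Union>t\<in>A. r t ` topspace K"
  obtain a where a: "range a \<subseteq> A"
      "\<And>x. x \<in> topspace K \<Longrightarrow> limitin K (\<lambda>n. r (a n) x) (r s x) sequentially"
    using lub_limit[OF assms] by blast
  have "?U \<subseteq> topspace K"
    using assms(1) in_topspace by blast
  then have sub: "?U \<subseteq> K closure_of ?U"
    by (rule closure_of_subset)
  show "r s ` topspace K \<subseteq> K closure_of ?U"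
  proof clarify
    fix x assume x: "x \<in> topspace K"
    have "r (a n) x \<in> K closure_of ?U" for n
      using a(1) x sub by blast
    then show "r s x \<in> K closure_of ?U"
      using limitin_closedin[OF a(2)[OF x] closedin_closure_of] by simp
  qed
  have "?U \<subseteq> r s ` topspace K"
    using image_mono assms(1,4) unfolding is_lub_def by blast
  then show "K closure_of ?U \<subseteq> r s ` topspace K"
    using closed_image assms(4) unfolding is_lub_def by (simp add: closure_of_minimal)
qed

text \<open>Directedness becomes countable directedness: dominate the sequence by an increasing one
  and take its supremum.\<close>

lemma upper_bound_seq:
  assumes "\<And>n::nat. b n \<in> \<Gamma>"
  obtains u where "u \<in> \<Gamma>" "\<And>n. le (b n) u"
proof -
  obtain a where a: "increasing_seq \<Gamma> le a" "\<And>n. le (b n) (a n)"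
    using up_directed_dominating_seq[of \<Gamma> le b, OF directed assms le_refl] by blast
  then obtain u where u: "is_sup_seq \<Gamma> le a u"
    using sigma unfolding sigma_complete_def by blast
  have "le (b n) u" for n
    using a u assms[of n] le_trans unfolding increasing_seq_def is_sup_seq_def transp_on_def by meson
  with u that show thesis
    unfolding is_sup_seq_def by blast
qed

lemma upper_bound2:
  assumes "s \<in> \<Gamma>" "t \<in> \<Gamma>"
  obtains u where "u \<in> \<Gamma>" "le s u" "le t u"
  using directed assms unfolding up_directed_def by blast

section \<open>Continuous real functions factor through a single retraction\<close>

lemma approx_point:
  assumes "continuous_map K euclideanreal f" "x \<in> topspace K" "e > 0"
  obtains s where "s \<in> \<Gamma>" "\<And>t. \<lbrakk>t \<in> \<Gamma>; le s t\<rbrakk> \<Longrightarrow> \<bar>f (r t x) - f x\<bar> < e"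
proof -
  have "limitin euclideanreal (f \<circ> (\<lambda>s. r s x)) (f x) (tails \<Gamma> le)"
    by (rule continuous_map_limit[OF assms(1) lim_net[OF assms(2)]])
  then have "eventually (\<lambda>s. dist (f (r s x)) (f x) < e) (tails \<Gamma> le)"
    using assms(3) by (simp add: tendsto_iff)
  then show thesis
    using that unfolding eventually_tails[OF poset directed] by (auto simp: dist_real_def)
qed

text \<open>If \<open>s\<^sub>n\<close> increases to \<open>s\<close> then \<open>r\<^sub>s\<^sub>n\<close> converges to \<open>r\<^sub>s\<close> continuously on \<open>r\<^sub>s[K]\<close>: the
  compositions \<open>r\<^sub>s\<^sub>m \<circ> r\<^sub>s\<^sub>n = r\<^sub>s\<^sub>m\<close> identify any two limit points.\<close>

lemma diagonal_limits_agree: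
  assumes "increasing_seq \<Gamma> le a" "is_sup_seq \<Gamma> le a s"
    and "\<And>n. X n \<in> topspace K" "x \<in> r s ` topspace K" "y \<in> r s ` topspace K" "strict_mono k"
    and "limitin K (X \<circ> k) x sequentially"
    and "limitin K ((\<lambda>n. r (a n) (X n)) \<circ> k) y sequentially"
  shows "x = y"
proof -
  have a: "a n \<in> \<Gamma>" for n
    using assms(1) unfolding increasing_seq_def by blast
  have s: "s \<in> \<Gamma>"
    using assms(2) unfolding is_sup_seq_def by blast
  have xy: "x \<in> topspace K" "y \<in> topspace K"
    using assms(7,8) limitin_topspace by fast+
  have eq: "r (a m) x = r (a m) y" for m
  proof (rule limitin_Hausdorff_unique[OF _ _ trivial_limit_sequentially Hausdorff])
    have cont: "continuous_map K K (r (a m))"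
      using continuous a by blast
    show "limitin K (r (a m) \<circ> (X \<circ> k)) (r (a m) x) sequentially"
      by (rule continuous_map_limit[OF cont assms(7)])
    \<comment> \<open>From index \<open>m\<close> on, both sequences have the same image under
      \<open>r (a m)\<close>, so the images of their limits agree.\<close>
    have "(r (a m) \<circ> ((\<lambda>n. r (a n) (X n)) \<circ> k)) n = (r (a m) \<circ> (X \<circ> k)) n" if "n \<ge> m" for n
    proof -
      have "m \<le> k n"
        using seq_suble[OF assms(6), of n] that by simp
      then have "le (a m) (a (k n))"
        using increasing_seq_mono[OF assms(1) le_refl le_trans] by blast
      then show ?thesis
        using comp_lower(2)[OF a a] assms(3) by simp
    qed
    then have "eventually (\<lambda>n. (r (a m) \<circ> ((\<lambda>n. r (a n) (X n)) \<circ> k)) n = (r (a m) \<circ> (X \<circ> k)) n) sequentially"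
      unfolding eventually_sequentially by blast
    then show "limitin K (r (a m) \<circ> (X \<circ> k)) (r (a m) y) sequentially"
      by (rule limitin_transform_eventually[OF _ continuous_map_limit[OF cont assms(8)]])
  qed
  have "r s x = r s y"
    using lim_sup[OF assms(1,2) xy(1)] lim_sup[OF assms(1,2) xy(2)] eq
      limitin_Hausdorff_unique[OF _ _ trivial_limit_sequentially Hausdorff] by simp
  then show ?thesis
    unfolding image_fixed[OF s assms(4)] image_fixed[OF s assms(5)] .
qed

text \<open>By contradiction. If no retraction preserves \<open>f\<close>, an error above a fixed
  \<open>e\<close> persists at all indices. This yields an increasing sequence of indices with
  points \<open>X n\<close> where the error exceeds \<open>e / 2\<close>; in the compact metrizable
  image at the supremum, \<open>diagonal_limits_agree\<close> forces these errors to zero along a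
  subsequence.\<close>

lemma factors_real:
  assumes f: "continuous_map K euclideanreal f"
  shows "\<exists>t\<in>\<Gamma>. \<forall>x\<in>topspace K. f (r t x) = f x"
proof (rule ccontr)
  assume no: "\<not> ?thesis"
  \<comment> \<open>Otherwise an upper bound \<open>u\<close> of indices with error at most
    \<open>1 / Suc n\<close> preserves \<open>f\<close> exactly: \<open>x\<close> and
    \<open>r u x\<close> have the same image under \<open>r (b n)\<close>, so their values under
    \<open>f\<close> differ by at most \<open>2 / Suc n\<close>.\<close>
  have "\<exists>e>0. \<forall>s\<in>\<Gamma>. \<exists>x\<in>topspace K. e < \<bar>f x - f (r s x)\<bar>"
  proof (rule ccontr)
    assume *: "\<not> ?thesis"
    have "\<exists>s\<in>\<Gamma>. \<forall>x\<in>topspace K. \<bar>f x - f (r s x)\<bar> \<le> e" if "e > 0" for e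
      using * that by (meson not_less)
    then have "\<forall>n::nat. \<exists>s\<in>\<Gamma>. \<forall>x\<in>topspace K. \<bar>f x - f (r s x)\<bar> \<le> 1 / Suc n"
      by simp
    then obtain b where b: "\<And>n. b n \<in> \<Gamma>"
        "\<And>n x. x \<in> topspace K \<Longrightarrow> \<bar>f x - f (r (b n) x)\<bar> \<le> 1 / Suc n"
      by metis
    obtain u where u: "u \<in> \<Gamma>" "\<And>n. le (b n) u"
      using upper_bound_seq[of b] b(1) by blast
    obtain x where x: "x \<in> topspace K" "f (r u x) \<noteq> f x"
      using no u(1) by auto
    then obtain n where n: "1 / Suc n < \<bar>f x - f (r u x)\<bar> / 2"
      using nat_approx_posE[of "\<bar>f x - f (r u x)\<bar> / 2"] by auto
    have "r (b n) (r u x) = r (b n) x"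
      using comp_lower(2) b(1) u x(1) by blast
    then show False
      using b(2)[of x n] b(2)[of "r u x" n] in_topspace[OF u(1) x(1)] x(1) n by auto
  qed
  then obtain e where e: "e > 0" "\<And>s. s \<in> \<Gamma> \<Longrightarrow> \<exists>x\<in>topspace K. e < \<bar>f x - f (r s x)\<bar>"
    by blast
  \<comment> \<open>The bad point \<open>x\<close> need not lie in any image; \<open>r t x\<close>
    for a large \<open>t\<close> replaces it, has the same image under \<open>r s\<close> and costs
    less than \<open>e / 2\<close>.\<close>
  have step: "\<exists>t\<in>\<Gamma>. le s t \<and> (\<exists>x\<in>r t ` topspace K. e / 2 < \<bar>f x - f (r s x)\<bar>)" if s: "s \<in> \<Gamma>" for s
  proof -
    obtain x where x: "x \<in> topspace K" "e < \<bar>f x - f (r s x)\<bar>"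
      using e(2) s by blast
    obtain s' where s': "s' \<in> \<Gamma>" "\<And>t. \<lbrakk>t \<in> \<Gamma>; le s' t\<rbrakk> \<Longrightarrow> \<bar>f (r t x) - f x\<bar> < e / 2"
      using approx_point[OF f x(1), of "e / 2"] e(1) by auto
    obtain t where t: "t \<in> \<Gamma>" "le s t" "le s' t"
      using upper_bound2[OF s s'(1)] by blast
    have eq: "r s (r t x) = r s x"
      using comp_lower(2) s t x(1) by blast
    have "e / 2 < \<bar>f (r t x) - f (r s (r t x))\<bar>"
      using s'(2)[OF t(1,3)] x(2) unfolding eq by linarith
    then show ?thesis
      using t x(1) by blast
  qed
  have "\<exists>a. \<forall>n::nat. a n \<in> \<Gamma> \<and> (le (a n) (a (Suc n)) \<and>
      (\<exists>x\<in>r (a (Suc n)) ` topspace K. e / 2 < \<bar>f x - f (r (a n) x)\<bar>))"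
  proof (rule dependent_nat_choice)
    show "\<exists>s. s \<in> \<Gamma>"
      using directed unfolding up_directed_def by blast
  qed (use step in blast)
  then obtain a where a: "\<And>n::nat. a n \<in> \<Gamma>" "\<And>n. le (a n) (a (Suc n))"
      "\<forall>n. \<exists>x. x \<in> r (a (Suc n)) ` topspace K \<and> e / 2 < \<bar>f x - f (r (a n) x)\<bar>"
    by blast
  from a(3) obtain X where X: "\<And>n. X n \<in> r (a (Suc n)) ` topspace K"
      "\<And>n. e / 2 < \<bar>f (X n) - f (r (a n) (X n))\<bar>"
    by metis
  have inc: "increasing_seq \<Gamma> le a"
    using a(1,2) unfolding increasing_seq_def by blast
  then obtain s where sup: "is_sup_seq \<Gamma> le a s"
    using sigma unfolding sigma_complete_def by blast
  then have s: "s \<in> \<Gamma>" "\<And>n. le (a n) s"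
    unfolding is_sup_seq_def by blast+
  let ?F = "r s ` topspace K"
  have sub: "r (a n) ` topspace K \<subseteq> ?F" for n
    using image_mono a(1) s by blast
  have XK: "X n \<in> topspace K" for n
    using X(1)[of n] imageE[OF X(1)[of n]] in_topspace[OF a(1)[of "Suc n"]] by metis
  have FK: "?F \<subseteq> topspace K"
    using in_topspace[OF s(1)] by (rule image_subsetI)
  have subseq: "\<exists>l k. l \<in> ?F \<and> strict_mono k \<and> limitin K (\<sigma> \<circ> k) l sequentially"
    if "range \<sigma> \<subseteq> ?F" for \<sigma> :: "nat \<Rightarrow> 'a"
  proof -
    have "range \<sigma> \<subseteq> topspace (subtopology K ?F)"
      using that FK by auto
    then obtain l k where "strict_mono k" "limitin (subtopology K ?F) (\<sigma> \<circ> k) l sequentially"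
      by (rule compact_metrizable_subseq[OF compact_space_subtopology[OF compact_image[OF s(1)]]
          metrizable_image[OF s(1)]])
    then show ?thesis
      unfolding limitin_subtopology by blast
  qed
  have "range X \<subseteq> ?F"
    using X(1) sub by blast
  then obtain x k where x: "x \<in> ?F" "strict_mono k" "limitin K (X \<circ> k) x sequentially"
    using subseq by blast
  \<comment> \<open>The second extraction refines the first, so both limits exist along
    \<open>k \<circ> j\<close>.\<close>
  have "range ((\<lambda>n. r (a n) (X n)) \<circ> k) \<subseteq> ?F"
    using sub XK by fastforce
  then obtain y j where y: "y \<in> ?F" "strict_mono j"
      "limitin K ((\<lambda>n. r (a n) (X n)) \<circ> k \<circ> j) y sequentially"
    using subseq by blast
  have kj: "strict_mono (k \<circ> j)"
    using x(2) y(2) strict_mono_o by blast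
  have lim_x: "limitin K (X \<circ> (k \<circ> j)) x sequentially"
    using limitin_subsequence[OF y(2) x(3)] by (simp add: o_assoc)
  have lim_y: "limitin K ((\<lambda>n. r (a n) (X n)) \<circ> (k \<circ> j)) y sequentially"
    using y(3) by (simp add: o_assoc)
  have "x = y"
    using diagonal_limits_agree[OF inc sup XK x(1) y(1) kj lim_x lim_y] .
  then have "(\<lambda>n. f (X (k (j n))) - f (r (a (k (j n))) (X (k (j n))))) \<longlonglongrightarrow> f x - f x"
    using continuous_map_limit[OF f lim_x] continuous_map_limit[OF f lim_y]
    by (intro tendsto_diff) (simp_all add: o_def)
  then have "eventually (\<lambda>n. \<bar>f (X (k (j n))) - f (r (a (k (j n))) (X (k (j n))))\<bar> < e / 2) sequentially"
    using tendstoD[of _ _ _ "e / 2"] e(1) by fastforce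
  then show False
    using X(2) unfolding eventually_sequentially by (meson order.asym order_refl)
qed

lemma factors_real_seq:
  fixes f :: "nat \<Rightarrow> 'a \<Rightarrow> real"
  assumes "\<And>n. continuous_map K euclideanreal (f n)"
  obtains t where "t \<in> \<Gamma>" "\<And>n x. x \<in> topspace K \<Longrightarrow> f n (r t x) = f n x"
proof -
  have "\<exists>t. t \<in> \<Gamma> \<and> (\<forall>x\<in>topspace K. f n (r t x) = f n x)" for n
    using factors_real[OF assms] by blast
  then obtain b where b: "\<And>n. b n \<in> \<Gamma>" "\<And>n x. x \<in> topspace K \<Longrightarrow> f n (r (b n) x) = f n x"
    by metis
  obtain u where u: "u \<in> \<Gamma>" "\<And>n. le (b n) u"
    using upper_bound_seq[of b] b(1) by blast
  \<comment> \<open>\<open>r u x\<close> and \<open>x\<close> have the same image under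
    \<open>r (b n)\<close>, and on \<open>K\<close> the value of \<open>f n\<close> depends only on
    that image.\<close>
  have "f n (r u x) = f n x" if "x \<in> topspace K" for n x
    using b(2)[of "r u x" n] b(2)[of x n] comp_lower(2)[OF b(1) u(1) u(2) that, of n]
      in_topspace[OF u(1) that] that by simp
  with u(1) that show thesis
    by blast
qed

text \<open>Separating functions on the compact metrizable image are pulled back along
  \<open>r s\<close>, which encodes \<open>r s\<close> in countably many real functions.\<close>

lemma separating_seq:
  assumes "s \<in> \<Gamma>"
  obtains f :: "nat \<Rightarrow> 'a \<Rightarrow> real" where "\<And>n. continuous_map K euclideanreal (\<lambda>x. f n (r s x))"
    "\<And>x y. \<lbrakk>x \<in> topspace K; y \<in> topspace K; \<And>n. f n (r s x) = f n (r s y)\<rbrakk> \<Longrightarrow> r s x = r s y"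
proof -
  let ?X = "subtopology K (r s ` topspace K)"
  have sub: "r s ` topspace K \<subseteq> topspace K"
    using in_topspace assms by blast
  have "compact_space ?X"
    using compact_image[OF assms] by (simp add: compact_space_subtopology)
  then obtain f :: "nat \<Rightarrow> 'a \<Rightarrow> real" where f: "\<And>n. continuous_map ?X euclideanreal (f n)"
      "\<And>x y. \<lbrakk>x \<in> topspace ?X; y \<in> topspace ?X; \<And>k. f k x = f k y\<rbrakk> \<Longrightarrow> x = y"
    using compact_metrizable_separating_seq[OF _ metrizable_image[OF assms]] by blast
  have "continuous_map K ?X (r s)"
    using continuous[OF assms] by (simp add: continuous_map_in_subtopology)
  then have "continuous_map K euclideanreal (\<lambda>x. f n (r s x))" for n
    using continuous_map_compose[OF _ f(1)[of n]] by (simp add: o_def)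
  moreover have "r s x = r s y"
    if "x \<in> topspace K" "y \<in> topspace K" "\<And>n. f n (r s x) = f n (r s y)" for x y
    using f(2)[of "r s x" "r s y"] that sub by auto
  ultimately show thesis
    using that by blast
qed

lemma dense_seq:
  assumes "s \<in> \<Gamma>"
  shows "\<exists>C. countable C \<and> C \<subseteq> r s ` topspace K \<and> r s ` topspace K \<subseteq> K closure_of C"
proof -
  let ?F = "r s ` topspace K"
  have "?F \<subseteq> topspace K"
    using in_topspace assms by blast
  then have top: "topspace (subtopology K ?F) = ?F"
    by auto
  have "separable_space (subtopology K ?F)"
    using compact_metrizable_imp_separable[OF _ metrizable_image[OF assms]]
      compact_space_subtopology[OF compact_image[OF assms]] .
  then obtain C where "countable C" "C \<subseteq> ?F" "subtopology K ?F closure_of C = ?F"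
    unfolding separable_space_def top by blast
  then show ?thesis
    using closure_of_subtopology_subset by metis
qed

text \<open>The skeleton axioms for \<open>R\<close> are inherited through \<open>\<phi>\<close>:
  the compatibility axiom by monotonicity, sequential limits by \<omega>-monotonicity, net limits by
  monotonicity and cofinality.\<close>

lemma weak_subskeletonI:
  assumes \<Lambda>: "poset \<Lambda> le'" "up_directed \<Lambda> le'" "sigma_complete \<Lambda> le'"
    and \<phi>: "\<And>i. i \<in> \<Lambda> \<Longrightarrow> \<phi> i \<in> \<Gamma>" "omega_monotone \<Lambda> le' \<Gamma> le \<phi>"
    and cofinal: "\<And>s. s \<in> \<Gamma> \<Longrightarrow> \<exists>i\<in>\<Lambda>. le s (\<phi> i)"
    and R: "\<And>i x. \<lbrakk>i \<in> \<Lambda>; x \<in> topspace K\<rbrakk> \<Longrightarrow> R i x = r (\<phi> i) x"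
  shows "weak_subskeleton K \<Lambda> le' R \<Gamma> le r"
proof -
  have img: "R i ` topspace K = r (\<phi> i) ` topspace K" if "i \<in> \<Lambda>" for i
    using R that by (intro image_cong) auto
  have mono: "le (\<phi> i) (\<phi> j)" if "i \<in> \<Lambda>" "j \<in> \<Lambda>" "le' i j" for i j
    using \<phi>(2) that unfolding omega_monotone_def by blast
  have seq: "limitin K (\<lambda>n. R (a n) x) (R i x) sequentially"
    if a: "increasing_seq \<Lambda> le' a" "is_sup_seq \<Lambda> le' a i" and x: "x \<in> topspace K" for a i x
  proof -
    have aI: "a n \<in> \<Lambda>" "le' (a n) (a (Suc n))" for n
      using a(1) unfolding increasing_seq_def by blast+
    have iI: "i \<in> \<Lambda>"
      using a(2) unfolding is_sup_seq_def by blast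
    have "increasing_seq \<Gamma> le (\<lambda>n. \<phi> (a n))"
      using aI \<phi>(1) mono unfolding increasing_seq_def by blast
    moreover have "is_sup_seq \<Gamma> le (\<lambda>n. \<phi> (a n)) (\<phi> i)"
      using \<phi>(2) a unfolding omega_monotone_def by blast
    ultimately show ?thesis
      using lim_sup x R aI(1) iI by simp
  qed
  have net: "limitin K (\<lambda>i. R i x) x (tails \<Lambda> le')" if x: "x \<in> topspace K" for x
    unfolding limitin_def eventually_tails[OF \<Lambda>(1,2)]
  proof (intro conjI allI impI x)
    fix U assume "openin K U \<and> x \<in> U"
    then obtain s where s: "s \<in> \<Gamma>" "\<And>t. \<lbrakk>t \<in> \<Gamma>; le s t\<rbrakk> \<Longrightarrow> r t x \<in> U"
      using lim_net[OF x] unfolding limitin_def eventually_tails[OF poset directed] by blast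
    obtain i where i: "i \<in> \<Lambda>" "le s (\<phi> i)"
      using cofinal s(1) by blast
    have "R j x \<in> U" if "j \<in> \<Lambda>" "le' i j" for j
    proof -
      have "le s (\<phi> j)"
        using mono[OF i(1) that] i(2) le_trans s(1) \<phi>(1) i(1) that(1)
        unfolding transp_on_def by blast
      then show ?thesis
        using s(2) \<phi>(1) R x that(1) by simp
    qed
    then show "\<exists>s\<in>\<Lambda>. \<forall>t\<in>\<Lambda>. le' s t \<longrightarrow> R t x \<in> U"
      using i(1) by blast
  qed
  have "retractional_skeleton K \<Lambda> le' R"
    unfolding retractional_skeleton_def
  proof (intro conjI ballI allI impI)
    fix i assume i: "i \<in> \<Lambda>"
    show "retraction_on K (R i)"
      using retraction_on_cong[OF retraction[OF \<phi>(1)[OF i]]] R[OF i] by blast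
    show "compactin K (R i ` topspace K)" "metrizable_space (subtopology K (R i ` topspace K))"
      using compact_image metrizable_image \<phi>(1) i img by simp_all
    fix j x assume j: "j \<in> \<Lambda>" "le' i j" and x: "x \<in> topspace K"
    show "R i x = R j (R i x)" "R i x = R i (R j x)"
      using comp_lower[OF \<phi>(1)[OF i] \<phi>(1)[OF j(1)] mono[OF i j] x] R i j(1) x in_topspace \<phi>(1)
      by simp_all
  qed (use \<Lambda> seq net in blast)+
  then show ?thesis
    unfolding weak_subskeleton_def using \<phi> cofinal R
    by (intro conjI exI[of _ \<phi>]) blast+
qed

end

section \<open>Skeletons inducing the same set\<close>

locale skeletons =
  fixes K :: "'v topology" and \<Gamma> :: "nat \<Rightarrow> 'v set" and le :: "nat \<Rightarrow> 'v \<Rightarrow> 'v \<Rightarrow> bool"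
    and r :: "nat \<Rightarrow> 'v \<Rightarrow> 'v \<Rightarrow> 'v" and D :: "'v set"
  assumes Hausdorff: "Hausdorff_space K"
    and skeletons: "retractional_skeleton K (\<Gamma> n) (le n) (r n)"
    and induced: "induced_set K (\<Gamma> n) (r n) = D"

sublocale skeletons \<subseteq> S: skeleton K "\<Gamma> n" "le n" "r n" for n
  using Hausdorff skeletons by unfold_locales

context skeletons
begin

lemma image_subset_D: "s \<in> \<Gamma> n \<Longrightarrow> r n s ` topspace K \<subseteq> D"
  using induced[of n] unfolding induced_set_def by blast

text \<open>Countably many functions separate the points of the image of \<open>r n s\<close>;
  composed with \<open>r n s\<close> they all factor through one retraction of the
  \<open>m\<close>-th skeleton, hence so does \<open>r n s\<close>.\<close>

lemma factor_through:
  assumes "s \<in> \<Gamma> n"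
  shows "\<exists>t. t \<in> \<Gamma> m \<and> (\<forall>x\<in>topspace K. r n s (r m t x) = r n s x)"
proof -
  obtain f :: "nat \<Rightarrow> 'v \<Rightarrow> real" where f: "\<And>k. continuous_map K euclideanreal (\<lambda>x. f k (r n s x))"
      "\<And>x y. \<lbrakk>x \<in> topspace K; y \<in> topspace K; \<And>k. f k (r n s x) = f k (r n s y)\<rbrakk> \<Longrightarrow> r n s x = r n s y"
    using S.separating_seq[OF assms] by blast
  obtain t where t: "t \<in> \<Gamma> m" "\<And>k x. x \<in> topspace K \<Longrightarrow> f k (r n s (r m t x)) = f k (r n s x)"
    using S.factors_real_seq[of "\<lambda>k x. f k (r n s x)" m] f(1) by blast
  have "r n s (r m t x) = r n s x" if "x \<in> topspace K" for x
    by (rule f(2)) (use that t S.in_topspace in blast)+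
  with t(1) show ?thesis
    by blast
qed

text \<open>The first condition gives suprema of \<open>M \<inter> \<Gamma> n\<close>. The second
  and third make the image at the supremum the closure of \<open>D \<inter> M\<close>, the same for
  all \<open>n\<close>. The last relates different skeletons, as in
  \<open>factor_through\<close>.\<close>

definition stable :: "'v set \<Rightarrow> bool" where
  "stable M \<longleftrightarrow>
     (\<forall>n. up_directed (M \<inter> \<Gamma> n) (le n)) \<and>
     (\<forall>n. \<forall>s\<in>M \<inter> \<Gamma> n. r n s ` topspace K \<subseteq> K closure_of (D \<inter> M)) \<and>
     (\<forall>n. \<forall>x\<in>M \<inter> D. \<exists>s\<in>M. s \<in> \<Gamma> n \<and> x \<in> r n s ` topspace K) \<and>
     (\<forall>n m. \<forall>s\<in>M \<inter> \<Gamma> n. \<exists>t\<in>M. t \<in> \<Gamma> m \<and> (\<forall>x\<in>topspace K. r n s (r m t x) = r n s x))"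

lemma on_club_dense:
  "on_club (\<lambda>M. \<forall>s\<in>M \<inter> \<Gamma> n. r n s ` topspace K \<subseteq> K closure_of (D \<inter> M))"
proof -
  have "\<forall>s\<in>\<Gamma> n. \<exists>C. countable C \<and> C \<subseteq> r n s ` topspace K \<and> r n s ` topspace K \<subseteq> K closure_of C"
    using S.dense_seq by blast
  then obtain C where C: "\<And>s. s \<in> \<Gamma> n \<Longrightarrow> countable (C s)"
      "\<And>s. s \<in> \<Gamma> n \<Longrightarrow> C s \<subseteq> r n s ` topspace K"
      "\<And>s. s \<in> \<Gamma> n \<Longrightarrow> r n s ` topspace K \<subseteq> K closure_of C s"
    by metis
  have "on_club (\<lambda>M. \<forall>s\<in>M \<inter> \<Gamma> n. C s \<subseteq> M)"
    using C(1) by (rule on_club_elems)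
  then show ?thesis
  proof (rule on_club_mono, intro ballI)
    fix M s assume "\<forall>s\<in>M \<inter> \<Gamma> n. C s \<subseteq> M" and s: "s \<in> M \<inter> \<Gamma> n"
    then have "C s \<subseteq> D \<inter> M"
      using C(2)[of s] image_subset_D[of s n] by blast
    then show "r n s ` topspace K \<subseteq> K closure_of (D \<inter> M)"
      using C(3)[of s] s closure_of_mono by blast
  qed
qed

lemma on_club_stable: "on_club stable"
  unfolding stable_def
proof (intro on_club_conj on_club_all)
  fix n m
  show "on_club (\<lambda>M. up_directed (M \<inter> \<Gamma> n) (le n))"
    by (rule on_club_up_directed[OF S.directed])
  show "on_club (\<lambda>M. \<forall>s\<in>M \<inter> \<Gamma> n. r n s ` topspace K \<subseteq> K closure_of (D \<inter> M))"
    by (rule on_club_dense)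
  show "on_club (\<lambda>M. \<forall>x\<in>M \<inter> D. \<exists>s\<in>M. s \<in> \<Gamma> n \<and> x \<in> r n s ` topspace K)"
    by (rule on_club_witness) (use induced[of n] in \<open>auto simp: induced_set_def\<close>)
  show "on_club (\<lambda>M. \<forall>s\<in>M \<inter> \<Gamma> n. \<exists>t\<in>M. t \<in> \<Gamma> m \<and> (\<forall>x\<in>topspace K. r n s (r m t x) = r n s x))"
    by (rule on_club_witness) (rule factor_through)
qed

section \<open>The retractions at the suprema of a countable stable set\<close>

definition lub :: "nat \<Rightarrow> 'v set \<Rightarrow> 'v" where
  "lub n M = (SOME s. is_lub (\<Gamma> n) (le n) (M \<inter> \<Gamma> n) s)"

lemma is_lub_lub:
  assumes "countable M" "stable M"
  shows "is_lub (\<Gamma> n) (le n) (M \<inter> \<Gamma> n) (lub n M)"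
proof -
  have "up_directed (M \<inter> \<Gamma> n) (le n)" "countable (M \<inter> \<Gamma> n)"
    using assms unfolding stable_def by auto
  then show ?thesis
    unfolding lub_def using S.lub_seq[of "M \<inter> \<Gamma> n" n] by (metis inf_le2 someI)
qed

lemma lub_in:
  assumes "countable M" "stable M"
  shows "lub n M \<in> \<Gamma> n" and "\<And>s. s \<in> M \<inter> \<Gamma> n \<Longrightarrow> le n s (lub n M)"
  using is_lub_lub[OF assms, of n] unfolding is_lub_def by blast+

lemma lub_limit:
  assumes "countable M" "stable M"
  obtains a where "\<And>k::nat. a k \<in> M \<inter> \<Gamma> n"
    "\<And>x. x \<in> topspace K \<Longrightarrow> limitin K (\<lambda>k. r n (a k) x) (r n (lub n M) x) sequentially"
proof -
  have *: "M \<inter> \<Gamma> n \<subseteq> \<Gamma> n" "countable (M \<inter> \<Gamma> n)" "up_directed (M \<inter> \<Gamma> n) (le n)"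
    using assms unfolding stable_def by auto
  obtain a where "range a \<subseteq> M \<inter> \<Gamma> n"
      "\<And>x. x \<in> topspace K \<Longrightarrow> limitin K (\<lambda>k. r n (a k) x) (r n (lub n M) x) sequentially"
    using S.lub_limit[OF * is_lub_lub[OF assms]] by blast
  then show thesis
    using that by blast
qed

lemma lub_image:
  assumes "countable M" "stable M"
  shows "r n (lub n M) ` topspace K = K closure_of (D \<inter> M)"
proof -
  let ?U = "\<Union>t\<in>M \<inter> \<Gamma> n. r n t ` topspace K"
  have "r n (lub n M) ` topspace K = K closure_of ?U"
    by (rule S.lub_image) (use assms is_lub_lub[OF assms] in \<open>auto simp: stable_def\<close>)
  moreover have "K closure_of ?U = K closure_of (D \<inter> M)"
  proof
    have "?U \<subseteq> K closure_of (D \<inter> M)"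
      using assms(2) unfolding stable_def by blast
    then show "K closure_of ?U \<subseteq> K closure_of (D \<inter> M)"
      by (rule closure_of_minimal) (rule closedin_closure_of)
    have "D \<inter> M \<subseteq> ?U"
      using assms(2) unfolding stable_def by blast
    then show "K closure_of (D \<inter> M) \<subseteq> K closure_of ?U"
      by (rule closure_of_mono)
  qed
  ultimately show ?thesis
    by simp
qed

lemma lub_agree:
  assumes M: "countable M" "stable M" and x: "x \<in> topspace K"
  shows "r n (lub n M) x = r m (lub m M) x"
proof -
  let ?y = "r m (lub m M) x"
  have y: "?y \<in> topspace K"
    using S.in_topspace lub_in(1)[OF M] x by blast
  obtain a where a: "\<And>k::nat. a k \<in> M \<inter> \<Gamma> n"
      "\<And>x. x \<in> topspace K \<Longrightarrow> limitin K (\<lambda>k. r n (a k) x) (r n (lub n M) x) sequentially"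
    using lub_limit[OF M] by blast
  \<comment> \<open>As \<open>t\<close> lies below \<open>lub m M\<close>, \<open>r m t\<close> does
    not distinguish \<open>x\<close> from \<open>?y\<close>; neither does \<open>r n (a k)\<close>,
    which factors through it.\<close>
  have "r n (a k) x = r n (a k) ?y" for k
  proof -
    obtain t where t: "t \<in> M" "t \<in> \<Gamma> m" "\<forall>x\<in>topspace K. r n (a k) (r m t x) = r n (a k) x"
      using M(2) a(1)[of k] unfolding stable_def by blast
    have "r m t ?y = r m t x"
      using S.comp_lower(2)[OF t(2) lub_in(1)[OF M] lub_in(2)[OF M] x] t(1,2) by blast
    then show ?thesis
      using t(3) x y by metis
  qed
  then have "limitin K (\<lambda>k. r n (a k) x) (r n (lub n M) ?y) sequentially"
    using a(2)[OF y] by simp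
  then have "r n (lub n M) x = r n (lub n M) ?y"
    using limitin_Hausdorff_unique[OF a(2)[OF x] _ trivial_limit_sequentially Hausdorff] by blast
  \<comment> \<open>\<open>?y\<close> lies in the common image, hence is fixed by the
    \<open>n\<close>-th retraction.\<close>
  moreover have "?y \<in> r n (lub n M) ` topspace K"
    using x lub_image[OF M, of m] lub_image[OF M, of n] by blast
  ultimately show ?thesis
    using S.image_fixed[OF lub_in(1)[OF M], of ?y n] by simp
qed

text \<open>One family and one choice of retractions serve all \<open>n\<close>: the map into
  \<open>\<Gamma> n\<close> is \<open>lub n\<close>, and \<open>lub_agree\<close> identifies its
  retractions with those of skeleton \<open>0\<close>.\<close>

lemma weak_subskeleton_closed_sets:
  assumes H: "\<And>xs. countable (H xs)" and stable: "\<And>M. closed_under H M \<Longrightarrow> stable M"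
  shows "weak_subskeleton K {M. countable M \<and> closed_under H M} (\<subseteq>) (\<lambda>M. r 0 (lub 0 M))
    (\<Gamma> n) (le n) (r n)"
proof -
  let ?\<M> = "{M. countable M \<and> closed_under H M}"
  have superset: "\<exists>M\<in>?\<M>. A \<subseteq> M" if A: "countable A" for A
  proof -
    obtain M where "A \<subseteq> M" "countable M" "closed_under H M"
      using closed_under_countable_superset[OF H A] .
    then show ?thesis
      by blast
  qed
  have lub: "is_lub (\<Gamma> n) (le n) (M \<inter> \<Gamma> n) (lub n M)" if "M \<in> ?\<M>" for M
    using is_lub_lub stable that by blast
  have lub_mono: "le n (lub n M) (lub n N)" if MN: "M \<in> ?\<M>" "N \<in> ?\<M>" "M \<subseteq> N" for M N
    using lub[OF MN(1)] lub[OF MN(2)] MN(3) unfolding is_lub_def by blast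
  have sup: "is_sup_seq ?\<M> (\<subseteq>) a (\<Union>k. a k)" if "increasing_seq ?\<M> (\<subseteq>) a" for a
  proof -
    have "closed_under H (\<Union>k. a k)"
      using that unfolding increasing_seq_def by (intro closed_under_UN_chain) auto
    moreover have "countable (\<Union>k. a k)"
      using that unfolding increasing_seq_def by simp
    ultimately show ?thesis
      unfolding is_sup_seq_def by blast
  qed
  show ?thesis
  proof (rule S.weak_subskeletonI)
    show "poset ?\<M> (\<subseteq>)"
      unfolding poset_def reflp_on_def antisymp_on_def transp_on_def by blast
    show "up_directed ?\<M> (\<subseteq>)"
      unfolding up_directed_def
    proof (intro conjI ballI)
      show "?\<M> \<noteq> {}"
        using superset[of "{}"] by blast
      fix M N assume "M \<in> ?\<M>" "N \<in> ?\<M>"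
      then obtain L where "L \<in> ?\<M>" "M \<union> N \<subseteq> L"
        using superset[of "M \<union> N"] by auto
      then show "\<exists>L\<in>?\<M>. M \<subseteq> L \<and> N \<subseteq> L"
        by blast
    qed
    show "sigma_complete ?\<M> (\<subseteq>)"
      unfolding sigma_complete_def using sup by blast
    show "lub n M \<in> \<Gamma> n" if "M \<in> ?\<M>" for M
      using lub[OF that] unfolding is_lub_def by blast
    show "omega_monotone ?\<M> (\<subseteq>) (\<Gamma> n) (le n) (lub n)"
      unfolding omega_monotone_def
    proof (intro conjI ballI allI impI)
      fix M N assume "M \<in> ?\<M>" "N \<in> ?\<M>" "M \<subseteq> N"
      then show "le n (lub n M) (lub n N)"
        by (rule lub_mono)
    next
      fix a M assume a: "increasing_seq ?\<M> (\<subseteq>) a \<and> is_sup_seq ?\<M> (\<subseteq>) a M"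
      \<comment> \<open>The union is itself in the family, so any supremum of \<open>a\<close>
        coincides with it.\<close>
      then have M: "M = (\<Union>k. a k)"
        using sup[of a] unfolding is_sup_seq_def by (intro antisym) blast+
      have M_in: "M \<in> ?\<M>"
        using a unfolding is_sup_seq_def by blast
      have a_in: "a k \<in> ?\<M>" for k
        using a unfolding increasing_seq_def by blast
      show "is_sup_seq (\<Gamma> n) (le n) (\<lambda>k. lub n (a k)) (lub n M)"
        unfolding is_sup_seq_def
      proof (intro conjI allI ballI impI)
        show "lub n M \<in> \<Gamma> n"
          using lub[OF M_in] unfolding is_lub_def by blast
        show "le n (lub n (a k)) (lub n M)" for k
          by (rule lub_mono[OF a_in M_in]) (use M in blast)
        fix u assume u: "u \<in> \<Gamma> n" "\<forall>k. le n (lub n (a k)) u"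
        \<comment> \<open>Every such \<open>s\<close> already lies in some \<open>a k\<close>, hence
          below \<open>lub n (a k)\<close> and below \<open>u\<close>.\<close>
        have "le n s u" if s: "s \<in> M \<inter> \<Gamma> n" for s
        proof -
          obtain k where "s \<in> a k \<inter> \<Gamma> n"
            using s M by blast
          then have "lub n (a k) \<in> \<Gamma> n" "le n s (lub n (a k))"
            using lub[OF a_in[of k]] unfolding is_lub_def by blast+
          then show ?thesis
            using u s S.le_trans[of n] unfolding transp_on_def by blast
        qed
        then show "le n (lub n M) u"
          using lub[OF M_in] u(1) unfolding is_lub_def by blast
      qed
    qed
    show "\<exists>M\<in>?\<M>. le n s (lub n M)" if s: "s \<in> \<Gamma> n" for s
    proof -
      obtain M where "M \<in> ?\<M>" "{s} \<subseteq> M"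
        using superset[of "{s}"] by auto
      then show ?thesis
        using lub[of M] s unfolding is_lub_def by blast
    qed
    show "r 0 (lub 0 M) x = r n (lub n M) x" if "M \<in> ?\<M>" "x \<in> topspace K" for M x
      using lub_agree stable that by blast
  qed
qed

end

section \<open>Elementary submodels and graphs\<close>

lemma finite_free_vars: "finite (free_vars p)"
  by (induction p) auto

lemma rel_holds_cong:
  assumes "\<And>i. i \<in> free_vars p \<Longrightarrow> v i = w i"
  shows "rel_holds E N p v \<longleftrightarrow> rel_holds E N p w"
  using assms
proof (induction p arbitrary: v w)
  case (Ex i p)
  have "rel_holds E N p (v(i := a)) \<longleftrightarrow> rel_holds E N p (w(i := a))" for a
    by (rule Ex.IH) (use Ex.prems in auto)
  then show ?case
    by simp
next
  case (All i p)
  have "rel_holds E N p (v(i := a)) \<longleftrightarrow> rel_holds E N p (w(i := a))" for a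
    by (rule All.IH) (use All.prems in auto)
  then show ?case
    by simp
next
  case (Neg p)
  show ?case
    using Neg.IH[of v w] Neg.prems by simp
next
  case (Conj p q)
  have "rel_holds E N p v = rel_holds E N p w" "rel_holds E N q v = rel_holds E N q w"
    using Conj.IH(1)[of v w] Conj.IH(2)[of v w] Conj.prems by auto
  then show ?case
    by simp
next
  case (Disj p q)
  have "rel_holds E N p v = rel_holds E N p w" "rel_holds E N q v = rel_holds E N q w"
    using Disj.IH(1)[of v w] Disj.IH(2)[of v w] Disj.prems by auto
  then show ?case
    by simp
next
  case (Imp p q)
  have "rel_holds E N p v = rel_holds E N p w" "rel_holds E N q v = rel_holds E N q w"
    using Imp.IH(1)[of v w] Imp.IH(2)[of v w] Imp.prems by auto
  then show ?case
    by simp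
next
  case (Iff p q)
  have "rel_holds E N p v = rel_holds E N p w" "rel_holds E N q v = rel_holds E N q w"
    using Iff.IH(1)[of v w] Iff.IH(2)[of v w] Iff.prems by auto
  then show ?case
    by simp
qed auto

text \<open>Parameters are passed to the witness functions as lists; positions of the list that are not
  free variables are filled with an arbitrary element \<open>m\<close> of the model.\<close>

lemma absolute_for_Ex:
  assumes p: "absolute_for E M p" and m: "m \<in> M"
    and witness: "\<forall>xs\<in>lists M. (\<exists>y. rel_holds E UNIV p (((!) xs)(i := y))) \<longrightarrow>
      (\<exists>y\<in>M. rel_holds E UNIV p (((!) xs)(i := y)))"
  shows "absolute_for E M (Ex i p)"
  unfolding absolute_for_def
proof (intro allI impI)
  fix v assume v: "\<forall>j\<in>free_vars (Ex i p). v j \<in> M"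
  have "rel_holds E M (Ex i p) v \<longleftrightarrow> (\<exists>a\<in>M. rel_holds E UNIV p (v(i := a)))"
    using p v unfolding absolute_for_def by auto
  also have "\<dots> \<longleftrightarrow> (\<exists>a. rel_holds E UNIV p (v(i := a)))"
  proof -
    obtain N where N: "\<And>j. j \<in> free_vars p \<Longrightarrow> j < N"
      using finite_free_vars finite_nat_set_iff_bounded by metis
    define xs where "xs = map (\<lambda>j. if j \<in> free_vars p - {i} then v j else m) [0..<N]"
    have "xs \<in> lists M"
      using v m by (auto simp: xs_def)
    \<comment> \<open>Position \<open>i\<close> is overwritten by \<open>a\<close>, so its filler is
      invisible; the other free variables agree with \<open>v\<close>.\<close>
    moreover have "rel_holds E UNIV p (((!) xs)(i := a)) \<longleftrightarrow> rel_holds E UNIV p (v(i := a))" for a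
      by (rule rel_holds_cong) (use N in \<open>auto simp: xs_def\<close>)
    ultimately show ?thesis
      using witness by blast
  qed
  finally show "rel_holds E M (Ex i p) v \<longleftrightarrow> rel_holds E UNIV (Ex i p) v"
    by simp
qed

lemma absolute_for_All: "absolute_for E M (All i p) \<longleftrightarrow> absolute_for E M (Neg (Ex i (Neg p)))"
  unfolding absolute_for_def by simp

lemma absolute_for_Neg: "absolute_for E M p \<Longrightarrow> absolute_for E M (Neg p)"
  unfolding absolute_for_def by simp

text \<open>The Tarski-Vaught test. \<open>undefined\<close> is put into \<open>M\<close> to have
  some element available as filler.\<close>

lemma on_club_absolute_Ex:
  assumes "on_club (\<lambda>M. absolute_for E M p)"
  shows "on_club (\<lambda>M. absolute_for E M (Ex i p))"
proof -
  have "on_club (\<lambda>M. absolute_for E M p \<and> {undefined} \<subseteq> M \<and>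
    (\<forall>xs\<in>lists M. (\<exists>y. rel_holds E UNIV p (((!) xs)(i := y))) \<longrightarrow>
      (\<exists>y\<in>M. rel_holds E UNIV p (((!) xs)(i := y)))))"
    by (intro on_club_conj on_club_superset on_club_witness_lists assms) simp
  then show ?thesis
  proof (rule on_club_mono, elim conjE)
    fix M assume "absolute_for E M p" "{undefined} \<subseteq> M"
      "\<forall>xs\<in>lists M. (\<exists>y. rel_holds E UNIV p (((!) xs)(i := y))) \<longrightarrow>
        (\<exists>y\<in>M. rel_holds E UNIV p (((!) xs)(i := y)))"
    then show "absolute_for E M (Ex i p)"
      by (intro absolute_for_Ex[of E M p undefined i]) simp_all
  qed
qed

lemma on_club_absolute: "on_club (\<lambda>M. absolute_for E M p)"
proof (induction p)
  case (Mem i j)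
  show ?case
    by (rule on_club_mono[OF on_club_superset[of "{}"]]) (auto simp: absolute_for_def)
next
  case (Eq i j)
  show ?case
    by (rule on_club_mono[OF on_club_superset[of "{}"]]) (auto simp: absolute_for_def)
next
  case (Neg p)
  then show ?case
    by (rule on_club_mono) (rule absolute_for_Neg)
next
  case (Ex i p)
  then show ?case
    by (rule on_club_absolute_Ex)
next
  case (All i p)
  then have "on_club (\<lambda>M. absolute_for E M (Neg p))"
    by (rule on_club_mono) (rule absolute_for_Neg)
  then have "on_club (\<lambda>M. absolute_for E M (Ex i (Neg p)))"
    by (rule on_club_absolute_Ex)
  then show ?case
    unfolding absolute_for_All by (rule on_club_mono) (rule absolute_for_Neg)
next
  case (Conj p q)
  show ?case
    by (rule on_club_mono[OF on_club_conj[OF Conj]]) (auto simp: absolute_for_def)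
next
  case (Disj p q)
  show ?case
    by (rule on_club_mono[OF on_club_conj[OF Disj]]) (auto simp: absolute_for_def)
next
  case (Imp p q)
  show ?case
    by (rule on_club_mono[OF on_club_conj[OF Imp]]) (auto simp: absolute_for_def)
next
  case (Iff p q)
  show ?case
    by (rule on_club_mono[OF on_club_conj[OF Iff]]) (auto simp: absolute_for_def)
qed

lemma on_club_absolute_list: "on_club (\<lambda>M. \<forall>p\<in>set \<Phi>. absolute_for E M p)"
proof (induction \<Phi>)
  case Nil
  show ?case
    by (rule on_club_mono[OF on_club_superset[of "{}"]]) auto
next
  case (Cons p \<Phi>)
  show ?case
    by (rule on_club_mono[OF on_club_conj[OF on_club_absolute[of E p] Cons]]) auto
qed

section \<open>Ordered pairs and graphs inside the universe of sets\<close>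

lemma is_pair_inject:
  assumes "is_pair E p x y" "is_pair E p x' y'"
  shows "x = x' \<and> y = y'"
proof -
  obtain a b where ab: "ext E a = {x}" "ext E b = {x, y}" "ext E p = {a, b}"
    using assms(1) unfolding is_pair_def by blast
  obtain a' b' where ab': "ext E a' = {x'}" "ext E b' = {x', y'}" "ext E p = {a', b'}"
    using assms(2) unfolding is_pair_def by blast
  have "a = a' \<and> b = b' \<or> a = b' \<and> b = a'"
    using ab(3) ab'(3) by (metis doubleton_eq_iff)
  then show ?thesis
  proof
    assume "a = a' \<and> b = b'"
    then have "{x} = {x'}" "{x, y} = {x', y'}"
      using ab(1,2) ab'(1,2) by simp_all
    then show ?thesis
      by (auto simp: doubleton_eq_iff)
  next
    \<comment> \<open>In the crossed case all four elements coincide.\<close>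
    assume "a = b' \<and> b = a'"
    then have "{x} = {x', y'}" "{x, y} = {x'}"
      using ab(1,2) ab'(1,2) by simp_all
    then show ?thesis
      by auto
  qed
qed

context
  fixes E :: "'v \<Rightarrow> 'v \<Rightarrow> bool"
  assumes universe: "set_universe E"
begin

lemma is_set_doubleton: "is_set E {x, y}"
  and is_set_Union: "is_set E (\<Union>y\<in>ext E a. ext E y)"
  and is_set_Pow: "is_set E {z. ext E z \<subseteq> ext E a}"
  using universe unfolding set_universe_def by simp_all

lemma is_set_subset:
  assumes "is_set E Y" "X \<subseteq> Y"
  shows "is_set E X"
  using assms universe unfolding set_universe_def is_set_def[of E Y] by blast

lemma is_pair_exists: "\<exists>p. is_pair E p x y"
proof -
  obtain a b where "ext E a = {x, x}" "ext E b = {x, y}"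
    using is_set_doubleton[of x x] is_set_doubleton[of x y] unfolding is_set_def by blast
  moreover obtain p where "ext E p = {a, b}"
    using is_set_doubleton[of a b] unfolding is_set_def by blast
  ultimately show ?thesis
    unfolding is_pair_def by auto
qed

lemma is_set_Un:
  assumes "is_set E X" "is_set E Y"
  shows "is_set E (X \<union> Y)"
proof -
  obtain a b where ab: "ext E a = X" "ext E b = Y"
    using assms unfolding is_set_def by blast
  obtain p where "ext E p = {a, b}"
    using is_set_doubleton[of a b] unfolding is_set_def by blast
  then show ?thesis
    using is_set_Union[of p] ab by simp
qed

text \<open>A Kuratowski pair is a subset of the power set of \<open>X \<union> Y\<close>, so
  separation carves the pairs out of a double power set.\<close>

lemma is_set_pairs:
  assumes "is_set E X" "is_set E Y"
  shows "is_set E {p. \<exists>x\<in>X. \<exists>y\<in>Y. is_pair E p x y}"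
proof -
  obtain u where u: "ext E u = X \<union> Y"
    using is_set_Un[OF assms] unfolding is_set_def by blast
  obtain P where P: "ext E P = {z. ext E z \<subseteq> ext E u}"
    using is_set_Pow[of u] unfolding is_set_def by blast
  have "{p. \<exists>x\<in>X. \<exists>y\<in>Y. is_pair E p x y} \<subseteq> {z. ext E z \<subseteq> ext E P}"
    unfolding P u is_pair_def by auto
  then show ?thesis
    by (rule is_set_subset[OF is_set_Pow])
qed

lemma is_graph_exists:
  assumes "is_set E (range c)" "is_set E (topspace K)"
  shows "\<exists>w. is_graph E c K f w"
proof -
  have "{p. \<exists>x\<in>topspace K. is_pair E p x (c (f x))}
      \<subseteq> {p. \<exists>x\<in>topspace K. \<exists>y\<in>range c. is_pair E p x y}"
    by blast
  then show ?thesis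
    using is_set_subset[OF is_set_pairs[OF assms(2,1)]] unfolding is_set_def is_graph_def by blast
qed

lemma is_graph_unique:
  assumes "inj c" "is_graph E c K f w" "is_graph E c K g w" "x \<in> topspace K"
  shows "f x = g x"
proof -
  obtain p where p: "is_pair E p x (c (f x))"
    using is_pair_exists by blast
  then have "p \<in> ext E w"
    using assms(2,4) unfolding is_graph_def by blast
  then obtain x' where "is_pair E p x' (c (g x'))"
    using assms(3) unfolding is_graph_def by blast
  then have "x = x'" "c (f x) = c (g x')"
    using is_pair_inject[OF p] by blast+
  then show ?thesis
    using injD[OF assms(1)] by blast
qed

end

section \<open>Canonical retractions\<close>

context skeletons
begin

text \<open>The index \<open>t\<close> is chosen from the code \<open>w\<close>, while invariance
  concerns functions; functions with code \<open>w\<close> agree on \<open>K\<close>, so one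
  \<open>t\<close> works for all of them.\<close>

lemma on_club_functions_factor:
  assumes "set_universe E" "inj c"
  shows "on_club (\<lambda>M. \<forall>w\<in>M \<inter> {w. \<exists>f. continuous_map K euclideanreal f \<and> is_graph E c K f w}.
    \<exists>t\<in>M. t \<in> \<Gamma> 0 \<and> (\<forall>f. is_graph E c K f w \<longrightarrow> (\<forall>x\<in>topspace K. f (r 0 t x) = f x)))"
proof (rule on_club_witness)
  fix w assume "w \<in> {w. \<exists>f. continuous_map K euclideanreal f \<and> is_graph E c K f w}"
  then obtain f where f: "continuous_map K euclideanreal f" "is_graph E c K f w"
    by blast
  obtain t where t: "t \<in> \<Gamma> 0" "\<forall>x\<in>topspace K. f (r 0 t x) = f x"
    using S.factors_real[OF f(1)] by blast
  have "g (r 0 t x) = g x" if "is_graph E c K g w" "x \<in> topspace K" for g x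
    using is_graph_unique[OF assms that(1) f(2)] S.in_topspace[OF t(1)] t(2) that(2) by simp
  with t(1) show "\<exists>t. t \<in> \<Gamma> 0 \<and>
      (\<forall>f. is_graph E c K f w \<longrightarrow> (\<forall>x\<in>topspace K. f (r 0 t x) = f x))"
    by blast
qed

lemma on_club_functions_separate:
  assumes "set_universe E" "is_set E (range c)" "is_set E (topspace K)"
  shows "on_club (\<lambda>M. \<forall>s\<in>M \<inter> \<Gamma> 0. \<forall>x\<in>topspace K. \<forall>y\<in>topspace K. r 0 s x \<noteq> r 0 s y \<longrightarrow>
    (\<exists>f\<in>cont_funs_in E c K M. f x \<noteq> f y))"
proof -
  \<comment> \<open>\<open>Sep s W\<close> states what a set \<open>W\<close> of codes must achieve
    for \<open>s\<close>. It passes to supersets of \<open>W\<close>, so closing \<open>M\<close>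
    under a countable choice \<open>W s\<close> suffices.\<close>
  define Sep where "Sep s W \<longleftrightarrow> (\<forall>x\<in>topspace K. \<forall>y\<in>topspace K. r 0 s x \<noteq> r 0 s y \<longrightarrow>
    (\<exists>f\<in>cont_funs_in E c K W. f x \<noteq> f y))" for s W
  have "\<forall>s\<in>\<Gamma> 0. \<exists>W. countable W \<and> Sep s W"
  proof
    fix s assume "s \<in> \<Gamma> 0"
    then obtain f :: "nat \<Rightarrow> 'v \<Rightarrow> real"
      where f: "\<And>k. continuous_map K euclideanreal (\<lambda>x. f k (r 0 s x))"
        "\<And>x y. \<lbrakk>x \<in> topspace K; y \<in> topspace K; \<And>k. f k (r 0 s x) = f k (r 0 s y)\<rbrakk>
          \<Longrightarrow> r 0 s x = r 0 s y"
      using S.separating_seq by blast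
    have "\<forall>k. \<exists>w. is_graph E c K (\<lambda>x. f k (r 0 s x)) w"
      using is_graph_exists[OF assms] by blast
    from choice[OF this] obtain w where w: "\<And>k. is_graph E c K (\<lambda>x. f k (r 0 s x)) (w k)"
      by blast
    have "Sep s (range w)"
      unfolding Sep_def
    proof (intro ballI impI)
      fix x y assume "x \<in> topspace K" "y \<in> topspace K" "r 0 s x \<noteq> r 0 s y"
      then obtain k where "f k (r 0 s x) \<noteq> f k (r 0 s y)"
        using f(2) by blast
      moreover have "(\<lambda>x. f k (r 0 s x)) \<in> cont_funs_in E c K (range w)"
        unfolding cont_funs_in_def using f(1) w by blast
      ultimately show "\<exists>f\<in>cont_funs_in E c K (range w). f x \<noteq> f y"
        by (intro bexI[of _ "\<lambda>x. f k (r 0 s x)"])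
    qed
    then show "\<exists>W. countable W \<and> Sep s W"
      by (intro exI[of _ "range w"]) simp
  qed
  then obtain W where W: "\<And>s. s \<in> \<Gamma> 0 \<Longrightarrow> countable (W s)" "\<And>s. s \<in> \<Gamma> 0 \<Longrightarrow> Sep s (W s)"
    by metis
  have "on_club (\<lambda>M. \<forall>s\<in>M \<inter> \<Gamma> 0. W s \<subseteq> M)"
    using W(1) by (rule on_club_elems)
  then show ?thesis
  proof (rule on_club_mono, intro ballI impI)
    fix M s x y
    assume M: "\<forall>s\<in>M \<inter> \<Gamma> 0. W s \<subseteq> M" and s: "s \<in> M \<inter> \<Gamma> 0"
      and xy: "x \<in> topspace K" "y \<in> topspace K" "r 0 s x \<noteq> r 0 s y"
    have "W s \<subseteq> M"
      using M s by blast
    then have "cont_funs_in E c K (W s) \<subseteq> cont_funs_in E c K M"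
      unfolding cont_funs_in_def by blast
    moreover obtain f where "f \<in> cont_funs_in E c K (W s)" "f x \<noteq> f y"
      using W(2)[of s] s xy unfolding Sep_def by blast
    ultimately show "\<exists>f\<in>cont_funs_in E c K M. f x \<noteq> f y"
      by blast
  qed
qed

text \<open>By \<open>factor\<close> the functions in \<open>M\<close> are invariant under
  \<open>r 0 (lub 0 M)\<close>, and by \<open>separate\<close> they separate the points of its
  image. A competing candidate has the same image and the same values under these functions, so it
  coincides with it.\<close>

lemma canonical_retraction_lub:
  assumes M: "countable M" "stable M"
    and factor: "\<forall>w\<in>M \<inter> {w. \<exists>f. continuous_map K euclideanreal f \<and> is_graph E c K f w}.
      \<exists>t\<in>M. t \<in> \<Gamma> 0 \<and> (\<forall>f. is_graph E c K f w \<longrightarrow> (\<forall>x\<in>topspace K. f (r 0 t x) = f x))"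
    and separate: "\<forall>s\<in>M \<inter> \<Gamma> 0. \<forall>x\<in>topspace K. \<forall>y\<in>topspace K. r 0 s x \<noteq> r 0 s y \<longrightarrow>
      (\<exists>f\<in>cont_funs_in E c K M. f x \<noteq> f y)"
  shows "canonical_retraction E c K D M (r 0 (lub 0 M))"
proof -
  let ?R = "r 0 (lub 0 M)"
  have R_in: "?R x \<in> topspace K" if "x \<in> topspace K" for x
    using S.in_topspace lub_in(1)[OF M] that by blast
  have inv: "f x = f (?R x)" if f: "f \<in> cont_funs_in E c K M" and x: "x \<in> topspace K" for f x
  proof -
    obtain w where w: "w \<in> M" "is_graph E c K f w" "continuous_map K euclideanreal f"
      using f unfolding cont_funs_in_def by blast
    then obtain t where t: "t \<in> M \<inter> \<Gamma> 0" "\<forall>x\<in>topspace K. f (r 0 t x) = f x"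
      using factor by blast
    have "r 0 t (?R x) = r 0 t x"
      using S.comp_lower(2)[OF _ lub_in(1)[OF M] lub_in(2)[OF M t(1)] x] t(1) by blast
    then show ?thesis
      using t(2) x R_in by metis
  qed
  have sep: "x = y" if "x \<in> ?R ` topspace K" "y \<in> ?R ` topspace K"
    and eq: "\<And>f. f \<in> cont_funs_in E c K M \<Longrightarrow> f x = f y" for x y
  proof -
    have xy: "x \<in> topspace K" "y \<in> topspace K"
      using that(1,2) R_in by blast+
    obtain a where a: "\<And>k::nat. a k \<in> M \<inter> \<Gamma> 0"
        "\<And>x. x \<in> topspace K \<Longrightarrow> limitin K (\<lambda>k. r 0 (a k) x) (?R x) sequentially"
      using lub_limit[OF M] by blast
    \<comment> \<open>If some \<open>r 0 (a k)\<close> told \<open>x\<close> and \<open>y\<close>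
      apart, so would a function in \<open>M\<close>; the limit then carries equality to the
      supremum.\<close>
    have "r 0 (a k) x = r 0 (a k) y" for k
      using separate a(1)[of k] xy eq by blast
    then have "?R x = ?R y"
      using limitin_Hausdorff_unique[OF a(2)[OF xy(1)] _ trivial_limit_sequentially Hausdorff]
        a(2)[OF xy(2)] by simp
    then show ?thesis
      using S.image_fixed[OF lub_in(1)[OF M] that(1)] S.image_fixed[OF lub_in(1)[OF M] that(2)] by simp
  qed
  have "canonical_candidate E c K D M ?R"
    unfolding canonical_candidate_def
    using S.retraction lub_in(1)[OF M] lub_image[OF M] inv by blast
  moreover have "r' x = ?R x" if "canonical_candidate E c K D M r'" "x \<in> topspace K" for r' x
  proof (rule sep)
    show "r' x \<in> ?R ` topspace K"
      using that lub_image[OF M] unfolding canonical_candidate_def by blast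
    show "f (r' x) = f (?R x)" if "f \<in> cont_funs_in E c K M" for f
      using inv \<open>canonical_candidate E c K D M r'\<close> \<open>x \<in> topspace K\<close> that
      unfolding canonical_candidate_def by metis
  qed (use that in blast)
  ultimately show ?thesis
    unfolding canonical_retraction_def by blast
qed

end

(* K and all index sets live in one type 'v, as in set theory. HOL needs a fixed type for the
   index set of the new skeleton: 'v set. In the second part the reals are identified with
   sets of the universe by an arbitrary injection c, and (K, Gamma_n) are sets of the universe. *)

theorem theorem21:
  fixes K :: "'v topology"
    and \<Gamma> :: "nat \<Rightarrow> 'v set"
    and le :: "nat \<Rightarrow> 'v \<Rightarrow> 'v \<Rightarrow> bool"
    and r :: "nat \<Rightarrow> 'v \<Rightarrow> 'v \<Rightarrow> 'v"
    and D :: "'v set"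
  assumes "compact_space K" and "Hausdorff_space K"
    and "\<And>n. retractional_skeleton K (\<Gamma> n) (le n) (r n)"
    and "\<And>n. induced_set K (\<Gamma> n) (r n) = D"
  shows "(\<exists>(\<Lambda> :: 'v set set) le' R.
            retractional_skeleton K \<Lambda> le' R \<and>
            (\<forall>n. weak_subskeleton K \<Lambda> le' R (\<Gamma> n) (le n) (r n)))
       \<and> (\<forall>(E :: 'v \<Rightarrow> 'v \<Rightarrow> bool) (c :: real \<Rightarrow> 'v).
            set_universe E \<and> inj c \<and> is_set E (range c) \<and>
            is_set E (topspace K) \<and> (\<forall>n. is_set E (\<Gamma> n)) \<longrightarrow>
            (\<forall>(S :: 'v set) (\<Phi> :: fm list). countable S \<longrightarrow>
              (\<exists>(\<M> :: 'v set set) (rM :: 'v set \<Rightarrow> 'v \<Rightarrow> 'v).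
                 (\<forall>M\<in>\<M>. countable M \<and> suitable_model E M \<Phi> S \<and>
                         canonical_retraction E c K D M (rM M)) \<and>
                 (\<forall>n. weak_subskeleton K \<M> (\<subseteq>) rM (\<Gamma> n) (le n) (r n)))))"
proof (intro conjI allI impI)
  interpret skeletons K \<Gamma> le r D
    using assms(2-4) by unfold_locales
  obtain H where H: "\<And>xs. countable (H xs)" "\<And>M. closed_under H M \<Longrightarrow> stable M"
    using on_clubE[OF on_club_stable] by blast
  have "weak_subskeleton K {M. countable M \<and> closed_under H M} (\<subseteq>) (\<lambda>M. r 0 (lub 0 M))
      (\<Gamma> n) (le n) (r n)" for n
    by (rule weak_subskeleton_closed_sets[OF H])
  then show "\<exists>(\<Lambda> :: 'v set set) le' R. retractional_skeleton K \<Lambda> le' R \<and>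
      (\<forall>n. weak_subskeleton K \<Lambda> le' R (\<Gamma> n) (le n) (r n))"
    unfolding weak_subskeleton_def by blast
next
  fix E :: "'v \<Rightarrow> 'v \<Rightarrow> bool" and c :: "real \<Rightarrow> 'v" and S :: "'v set" and \<Phi> :: "fm list"
  assume univ: "set_universe E \<and> inj c \<and> is_set E (range c) \<and>
    is_set E (topspace K) \<and> (\<forall>n. is_set E (\<Gamma> n))" and S: "countable S"
  interpret skeletons K \<Gamma> le r D
    using assms(2-4) by unfold_locales
  \<comment> \<open>Stability yields the weak subskeleton. The other conjuncts give \<open>S\<close>
    inside \<open>M\<close>, absoluteness of \<Phi>, and the two conditions of
    \<open>canonical_retraction_lub\<close>.\<close>
  define P where "P M \<longleftrightarrow> stable M \<and> S \<subseteq> M \<and> (\<forall>p\<in>set \<Phi>. absolute_for E M p) \<and>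
    (\<forall>w\<in>M \<inter> {w. \<exists>f. continuous_map K euclideanreal f \<and> is_graph E c K f w}.
      \<exists>t\<in>M. t \<in> \<Gamma> 0 \<and> (\<forall>f. is_graph E c K f w \<longrightarrow> (\<forall>x\<in>topspace K. f (r 0 t x) = f x))) \<and>
    (\<forall>s\<in>M \<inter> \<Gamma> 0. \<forall>x\<in>topspace K. \<forall>y\<in>topspace K. r 0 s x \<noteq> r 0 s y \<longrightarrow>
      (\<exists>f\<in>cont_funs_in E c K M. f x \<noteq> f y))" for M
  have P: "on_club P"
    unfolding P_def[abs_def]
    by (intro on_club_conj on_club_stable on_club_superset on_club_absolute_list
        on_club_functions_factor on_club_functions_separate) (use univ S in blast)+
  obtain H where H: "\<And>xs. countable (H xs)" "\<And>M. closed_under H M \<Longrightarrow> P M"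
    using on_clubE[OF P] by blast
  let ?\<M> = "{M. countable M \<and> closed_under H M}"
  have "suitable_model E M \<Phi> S" if "M \<in> ?\<M>" for M
    using H(2)[of M] that unfolding suitable_model_def P_def by blast
  moreover have "canonical_retraction E c K D M (r 0 (lub 0 M))" if M: "M \<in> ?\<M>" for M
  proof -
    have "P M"
      using H(2) M by blast
    then show ?thesis
      using M unfolding P_def by (intro canonical_retraction_lub) simp_all
  qed
  moreover
  have stable: "stable M" if "closed_under H M" for M
    using H(2)[OF that] unfolding P_def by blast
  have "weak_subskeleton K ?\<M> (\<subseteq>) (\<lambda>M. r 0 (lub 0 M)) (\<Gamma> n) (le n) (r n)" for n
    by (rule weak_subskeleton_closed_sets[OF H(1) stable])
  ultimately show "\<exists>(\<M> :: 'v set set) (rM :: 'v set \<Rightarrow> 'v \<Rightarrow> 'v).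
      (\<forall>M\<in>\<M>. countable M \<and> suitable_model E M \<Phi> S \<and> canonical_retraction E c K D M (rM M)) \<and>
      (\<forall>n. weak_subskeleton K \<M> (\<subseteq>) rM (\<Gamma> n) (le n) (r n))"
    by (intro exI[of _ ?\<M>] exI[of _ "\<lambda>M. r 0 (lub 0 M)"]) blast
qed

end
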